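(* Let $d\ge2$, let $X=(X_1,\dots,X_d)$ be a random vector with components $X_j\in\mathbb{R}^{p_j}$, and let $X^1,X^2,\dots$ be i.i.d. with the distribution of $X$; for each $n$ put $\mathbf{X}=\{X^1,\dots,X^n\}$. Let $$\mathcal{R}(X)=\sum_{c=1}^{d-1}\mathcal{V}^2((X_c,X_{c^+})),\quad \mathcal{S}(X)=\sum_{c=1}^{d}\mathcal{V}^2((X_c,X_{-c})),$$ $$\mathcal{R}_n(\mathbf{X})=\sum_{c=1}^{d-1}\mathcal{V}_n^2((\mathbf{X}_c,\mathbf{X}_{c^+})),\quad \mathcal{S}_n(\mathbf{X})=\sum_{c=1}^{d}\mathcal{V}_n^2((\mathbf{X}_c,\mathbf{X}_{-c})).$$ If $\mathrm{E}|X|<\infty$, then almost surely, as $n\to\infty$, $\mathcal{R}_n(\mathbf{X})\to\mathcal{R}(X)$ and $\mathcal{S}_n(\mathbf{X})\to\mathcal{S}(X)$.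
   Context: Each component $X_j$ is a continuous random vector in $\mathbb{R}^{p_j}$ (its distribution is absolutely continuous with respect to Lebesgue measure). $|\cdot|$ is the Euclidean norm (modulus for complex numbers), $\langle\cdot,\cdot\rangle$ the Euclidean inner product. $X_{c^+}=(X_{c+1},\dots,X_d)$ for $c=0,\dots,d-1$; $X_{-c}=(X_1,\dots,X_{c-1},X_{c+1},\dots,X_d)$ for $c=1,\dots,d$; $\mathbf{X}_c,\mathbf{X}_{c^+},\mathbf{X}_{-c}$ are the corresponding samples of size $n$ extracted from $\mathbf{X}$. For a pair of random vectors $Y\in\mathbb{R}^a$, $Z\in\mathbb{R}^b$, the squared distance covariance is $$\mathcal{V}^2((Y,Z))=\int_{\mathbb{R}^{a+b}}|\phi_{(Y,Z)}(u,v)-\phi_Y(u)\phi_Z(v)|^2\,w_0(u,v)\,du\,dv,\qquad w_0(u,v)=\big(K_aK_b|u|^{a+1}|v|^{b+1}\big)^{-1},$$ where $\phi$ denotes characteristic functions ($\phi_Y(u)=\mathrm{E}[e^{i\langle u,Y\rangle}]$, etc.) and $K_q=\frac{\pi^{(q+1)/2}}{\Gamma((q+1)/2)}$. For a sample $(\mathbf{Y},\mathbf{Z})=\{(Y^k,Z^k)\}_{k=1}^n$, the empirical version $\mathcal{V}_n^2((\mathbf{Y},\mathbf{Z}))$ is obtained by replacing $\phi_{(Y,Z)},\phi_Y,\phi_Z$ in this integral by the empirical characteristic functions $\phi^n_{(Y,Z)}(u,v)=\frac1n\sum_{k=1}^ne^{i\langle u,Y^k\rangle+i\langle v,Z^k\rangle}$,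 $\phi_Y^n(u)=\frac1n\sum_{k=1}^ne^{i\langle u,Y^k\rangle}$, $\phi_Z^n(v)=\frac1n\sum_{k=1}^ne^{i\langle v,Z^k\rangle}$. *)

theory Defs
  imports "HOL-Probability.Probability"
begin

text \<open>
  The dimensions of the vectors below are sums of a varying number of the \<open>p j\<close>, so
  Euclidean space is rendered as \<open>\<real>\<^sup>I\<close> for a finite set \<open>I\<close> of coordinates: its elements are
  the extensional functions on \<open>I\<close>, its dimension is \<open>card I\<close>, its Euclidean norm is
  \<open>\<lambda>u. L2_set u I\<close>.
\<close>

definition leb_on :: "'i set \<Rightarrow> ('i \<Rightarrow> real) measure"
  where "leb_on I = Pi\<^sub>M I (\<lambda>_. lborel)"

definition inner_on :: "'i set \<Rightarrow> ('i \<Rightarrow> real) \<Rightarrow> ('i \<Rightarrow> real) \<Rightarrow> real"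
  where "inner_on I u x = (\<Sum>i\<in>I. u i * x i)"

definition char_fun :: "'a measure \<Rightarrow> 'i set \<Rightarrow> ('a \<Rightarrow> 'i \<Rightarrow> real) \<Rightarrow> ('i \<Rightarrow> real) \<Rightarrow> complex"
  where "char_fun M A Y u = (CLINT \<omega>|M. iexp (inner_on A u (Y \<omega>)))"

definition joint_char_fun ::
  "'a measure \<Rightarrow> 'i set \<Rightarrow> ('a \<Rightarrow> 'i \<Rightarrow> real) \<Rightarrow> 'j set \<Rightarrow> ('a \<Rightarrow> 'j \<Rightarrow> real)
    \<Rightarrow> ('i \<Rightarrow> real) \<Rightarrow> ('j \<Rightarrow> real) \<Rightarrow> complex"
  where "joint_char_fun M A Y B Z u v =
    (CLINT \<omega>|M. iexp (inner_on A u (Y \<omega>) + inner_on B v (Z \<omega>)))"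

definition emp_char_fun :: "nat \<Rightarrow> 'i set \<Rightarrow> (nat \<Rightarrow> 'i \<Rightarrow> real) \<Rightarrow> ('i \<Rightarrow> real) \<Rightarrow> complex"
  where "emp_char_fun n A y u = (\<Sum>k=1..n. iexp (inner_on A u (y k))) / of_nat n"

definition emp_joint_char_fun ::
  "nat \<Rightarrow> 'i set \<Rightarrow> (nat \<Rightarrow> 'i \<Rightarrow> real) \<Rightarrow> 'j set \<Rightarrow> (nat \<Rightarrow> 'j \<Rightarrow> real)
    \<Rightarrow> ('i \<Rightarrow> real) \<Rightarrow> ('j \<Rightarrow> real) \<Rightarrow> complex"
  where "emp_joint_char_fun n A y B z u v =
    (\<Sum>k=1..n. iexp (inner_on A u (y k) + inner_on B v (z k))) / of_nat n"

definition dcov_const :: "nat \<Rightarrow> real"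
  where "dcov_const q = pi powr ((real q + 1) / 2) / Gamma ((real q + 1) / 2)"

text \<open>
  Where \<open>u\<close> or \<open>v\<close> vanishes (a null set, for nonempty \<open>A\<close> and \<open>B\<close>) the weight is \<open>0\<close>.
\<close>

definition dcov_weight :: "'i set \<Rightarrow> 'j set \<Rightarrow> ('i \<Rightarrow> real) \<Rightarrow> ('j \<Rightarrow> real) \<Rightarrow> real"
  where "dcov_weight A B u v =
    inverse (dcov_const (card A) * dcov_const (card B)
      * L2_set u A ^ (card A + 1) * L2_set v B ^ (card B + 1))"

text \<open>
  The integrals are taken in \<open>[0, \<infinity>]\<close>, so that a divergent integral is not silently \<open>0\<close>.
\<close>

definition dcov_integral ::
  "'i set \<Rightarrow> 'j set \<Rightarrow> (('i \<Rightarrow> real) \<Rightarrow> ('j \<Rightarrow> real) \<Rightarrow> complex)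
    \<Rightarrow> (('i \<Rightarrow> real) \<Rightarrow> complex) \<Rightarrow> (('j \<Rightarrow> real) \<Rightarrow> complex) \<Rightarrow> ennreal"
  where "dcov_integral A B f g h =
    (\<integral>\<^sup>+ (u, v). ennreal ((cmod (f u v - g u * h v))\<^sup>2 * dcov_weight A B u v)
      \<partial>(leb_on A \<Otimes>\<^sub>M leb_on B))"

definition dcov2 ::
  "'a measure \<Rightarrow> 'i set \<Rightarrow> ('a \<Rightarrow> 'i \<Rightarrow> real) \<Rightarrow> 'j set \<Rightarrow> ('a \<Rightarrow> 'j \<Rightarrow> real) \<Rightarrow> ennreal"
  where "dcov2 M A Y B Z =
    dcov_integral A B (joint_char_fun M A Y B Z) (char_fun M A Y) (char_fun M B Z)"

definition emp_dcov2 ::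
  "nat \<Rightarrow> 'i set \<Rightarrow> (nat \<Rightarrow> 'i \<Rightarrow> real) \<Rightarrow> 'j set \<Rightarrow> (nat \<Rightarrow> 'j \<Rightarrow> real) \<Rightarrow> ennreal"
  where "emp_dcov2 n A y B z =
    dcov_integral A B (emp_joint_char_fun n A y B z) (emp_char_fun n A y) (emp_char_fun n B z)"

text \<open>
  A vector with components indexed by \<open>J\<close>, the \<open>j\<close>-th one of dimension \<open>p j\<close>, has a coordinate \<open>(j, i)\<close>
  for each \<open>j \<in> J\<close> and \<open>i \<in> {1..p j}\<close>.
\<close>

definition coords :: "(nat \<Rightarrow> nat) \<Rightarrow> nat set \<Rightarrow> (nat \<times> nat) set"
  where "coords p J = (SIGMA j:J. {1..p j})"

definition subvec :: "(nat \<Rightarrow> nat) \<Rightarrow> nat set \<Rightarrow> (nat \<times> nat \<Rightarrow> real) \<Rightarrow> (nat \<times> nat \<Rightarrow> real)"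
  where "subvec p J x = restrict x (coords p J)"

definition dcov2_parts ::
  "(nat \<Rightarrow> nat) \<Rightarrow> 'a measure \<Rightarrow> ('a \<Rightarrow> nat \<times> nat \<Rightarrow> real) \<Rightarrow> nat set \<Rightarrow> nat set \<Rightarrow> ennreal"
  where "dcov2_parts p M X J K =
    dcov2 M (coords p J) (\<lambda>\<omega>. subvec p J (X \<omega>)) (coords p K) (\<lambda>\<omega>. subvec p K (X \<omega>))"

definition emp_dcov2_parts ::
  "(nat \<Rightarrow> nat) \<Rightarrow> nat \<Rightarrow> (nat \<Rightarrow> nat \<times> nat \<Rightarrow> real) \<Rightarrow> nat set \<Rightarrow> nat set \<Rightarrow> ennreal"
  where "emp_dcov2_parts p n x J K =
    emp_dcov2 n (coords p J) (\<lambda>k. subvec p J (x k)) (coords p K) (\<lambda>k. subvec p K (x k))"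

definition R_dcov :: "nat \<Rightarrow> (nat \<Rightarrow> nat) \<Rightarrow> 'a measure \<Rightarrow> ('a \<Rightarrow> nat \<times> nat \<Rightarrow> real) \<Rightarrow> ennreal"
  where "R_dcov d p M X = (\<Sum>c=1..d-1. dcov2_parts p M X {c} {c+1..d})"

definition S_dcov :: "nat \<Rightarrow> (nat \<Rightarrow> nat) \<Rightarrow> 'a measure \<Rightarrow> ('a \<Rightarrow> nat \<times> nat \<Rightarrow> real) \<Rightarrow> ennreal"
  where "S_dcov d p M X = (\<Sum>c=1..d. dcov2_parts p M X {c} ({1..d} - {c}))"

definition emp_R_dcov :: "nat \<Rightarrow> (nat \<Rightarrow> nat) \<Rightarrow> nat \<Rightarrow> (nat \<Rightarrow> nat \<times> nat \<Rightarrow> real) \<Rightarrow> ennreal"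
  where "emp_R_dcov d p n x = (\<Sum>c=1..d-1. emp_dcov2_parts p n x {c} {c+1..d})"

definition emp_S_dcov :: "nat \<Rightarrow> (nat \<Rightarrow> nat) \<Rightarrow> nat \<Rightarrow> (nat \<Rightarrow> nat \<times> nat \<Rightarrow> real) \<Rightarrow> ennreal"
  where "emp_S_dcov d p n x = (\<Sum>c=1..d. emp_dcov2_parts p n x {c} ({1..d} - {c}))"

end

theory Submission
  imports Defs
begin

text \<open>
  The integrand of the empirical distance covariance is dominated, by Cauchy--Schwarz, by a constant
  times \<open>(1 - Re \<phi>\<^sup>n\<^sub>Y(u)) (1 - Re \<phi>\<^sup>n\<^sub>Z(v)) w\<^sub>0(u, v)\<close>. This bound factors, and its integral is the product
  of the empirical means of \<open>h(Y\<^sup>k)\<close> and \<open>h(Z\<^sup>k)\<close>, where the integral \<open>h(y)\<close> of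
  \<open>(1 - cos \<langle>u, y\<rangle>) / (K\<^sub>a |u|\<^sup>a\<^sup>+\<^sup>1)\<close> over \<open>u\<close> is at most a constant times \<open>|y|\<close>. The strong law of large numbers
  makes these means converge, and, through Fubini, it makes the empirical characteristic functions
  converge for almost all \<open>(u, v)\<close> almost surely. Pratt's version of dominated convergence then yields
  the convergence of the integrals. The strong law itself is obtained by truncation: Hoeffding's
  inequality and Borel--Cantelli handle the bounded part, a maximal inequality the remainder.
\<close>

subsection \<open>The strong law of large numbers\<close>

text \<open>Maximum of the partial sums of orders \<open>0, \<dots>, n\<close>; the recursion peels off the first term, as needed in
  Garsia's proof of the maximal ergodic theorem.\<close>

fun max_psum :: "nat \<Rightarrow> (nat \<Rightarrow> real) \<Rightarrow> real" where
  "max_psum 0 w = 0"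
| "max_psum (Suc n) w = max 0 (w 0 + max_psum n (\<lambda>k. w (Suc k)))"

lemma max_psum_nonneg: "max_psum n w \<ge> 0"
  by (cases n) auto

lemma max_psum_le_Suc: "max_psum n w \<le> max_psum (Suc n) w"
proof (induction n arbitrary: w)
  case (Suc n)
  show ?case using Suc[of "\<lambda>k. w (Suc k)"] by auto
qed auto

lemma psum_le_max_psum: "m \<le> n \<Longrightarrow> (\<Sum>k<m. w k) \<le> max_psum n w"
proof (induction n arbitrary: w m)
  case (Suc n)
  show ?case
  proof (cases m)
    case (Suc m')
    then show ?thesis
      using Suc.IH[of m' "\<lambda>k. w (Suc k)"] Suc.prems by (simp add: sum.lessThan_Suc_shift del: sum.lessThan_Suc)
  qed simp
qed simp

lemma measurable_max_psum [measurable]: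
  assumes "\<And>k. V k \<in> borel_measurable M"
  shows "(\<lambda>\<omega>. max_psum n (\<lambda>k. V k \<omega>)) \<in> borel_measurable M"
  using assms
proof (induction n arbitrary: V)
  case (Suc n)
  have [measurable]: "(\<lambda>\<omega>. max_psum n (\<lambda>k. V (Suc k) \<omega>)) \<in> borel_measurable M"
    using Suc.prems by (intro Suc.IH)
  have [measurable]: "V 0 \<in> borel_measurable M" by fact
  show ?case by simp
qed simp

lemma integrable_max_psum:
  assumes "\<And>k. integrable M (V k)"
  shows "integrable M (\<lambda>\<omega>. max_psum n (\<lambda>k. V k \<omega>))"
  using assms
proof (induction n arbitrary: V)
  case (Suc n)
  then show ?case
    by (simp del: max.absorb1 max.absorb2)
qed simp

section \<open>Reindexing of independent families, and i.i.d. sequences\<close>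

lemma (in prob_space) indep_sets_reindex:
  assumes f: "inj_on f I" and F: "indep_sets F (f ` I)"
  shows "indep_sets (\<lambda>i. F (f i)) I"
proof (rule indep_setsI)
  show "F (f i) \<subseteq> events" if "i \<in> I" for i
    using F that by (auto simp: indep_sets_def)
  fix A J assume J: "J \<noteq> {}" "J \<subseteq> I" "finite J" and A: "\<forall>j\<in>J. A j \<in> F (f j)"
  have inj: "inj_on f J" using f J by (auto intro: inj_on_subset)
  define A' where "A' k = A (the_inv_into J f k)" for k
  have A': "A' (f j) = A j" if "j \<in> J" for j
    using that by (simp add: A'_def the_inv_into_f_f[OF inj])
  have "prob (\<Inter>k\<in>f ` J. A' k) = (\<Prod>k\<in>f ` J. prob (A' k))"
    by (rule indep_setsD[OF F]) (use J A A' in auto)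
  then show "prob (\<Inter>j\<in>J. A j) = (\<Prod>j\<in>J. prob (A j))"
    using A' by (simp add: prod.reindex[OF inj])
qed

lemma (in prob_space) indep_vars_reindex:
  assumes "inj_on f I" "indep_vars M' X (f ` I)"
  shows "indep_vars (\<lambda>i. M' (f i)) (\<lambda>i. X (f i)) I"
  using assms indep_sets_reindex[OF assms(1)]
  by (auto simp: indep_vars_def2)

text \<open>The values lie in an arbitrary space \<open>S\<close>, so that whole sample vectors fit;
  real or complex statistics of them enter as functions of \<open>W k \<omega>\<close>. Indices
  start at 0, while samples start at 1 and are therefore fed in as
  \<open>Xs (Suc k)\<close>.\<close>

locale iid_seq = prob_space M for M :: "'b measure" +
  fixes S :: "'c measure" and W :: "nat \<Rightarrow> 'b \<Rightarrow> 'c"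
  assumes indep: "indep_vars (\<lambda>_. S) W UNIV"
    and distr_eq: "distr M S (W k) = distr M S (W 0)"
begin

lemma measurable_W [measurable]: "W k \<in> measurable M S"
  using indep unfolding indep_vars_def by auto

lemma iid_seq_compose:
  assumes [measurable]: "h \<in> measurable S T"
  shows "iid_seq M T (\<lambda>k \<omega>. h (W k \<omega>))"
proof
  show "indep_vars (\<lambda>_. T) (\<lambda>k \<omega>. h (W k \<omega>)) UNIV"
    by (rule indep_vars_compose2[OF indep]) simp
  have "distr M T (\<lambda>\<omega>. h (W k \<omega>)) = distr (distr M S (W k)) T h" for k
    by (simp add: distr_distr comp_def)
  then show "distr M T (\<lambda>\<omega>. h (W k \<omega>)) = distr M T (\<lambda>\<omega>. h (W 0 \<omega>))" for k
    using distr_eq[of k] by simp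
qed

lemma integrable_eq:
  fixes h :: "'c \<Rightarrow> real"
  assumes [measurable]: "h \<in> borel_measurable S"
  shows "integrable M (\<lambda>\<omega>. h (W k \<omega>)) \<longleftrightarrow> integrable M (\<lambda>\<omega>. h (W 0 \<omega>))"
  using integrable_distr_eq[of "W k" M S h] integrable_distr_eq[of "W 0" M S h] distr_eq[of k] by simp

text \<open>By independence both laws are products of the marginals, and all marginals agree. This
  stationarity takes the place of the measure-preserving shift in the maximal ergodic
  theorem.\<close>

lemma distr_shift:
  "distr M (Pi\<^sub>M UNIV (\<lambda>_. S)) (\<lambda>\<omega> k. W (Suc k) \<omega>) = distr M (Pi\<^sub>M UNIV (\<lambda>_. S)) (\<lambda>\<omega> k. W k \<omega>)"
proof -
  have "indep_vars (\<lambda>_. S) (\<lambda>k. W (Suc k)) UNIV"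
    by (rule indep_vars_reindex[of Suc UNIV "\<lambda>_. S" W]) (auto intro: indep_vars_subset[OF indep])
  then have "distr M (Pi\<^sub>M UNIV (\<lambda>_. S)) (\<lambda>\<omega> k. W (Suc k) \<omega>)
      = Pi\<^sub>M UNIV (\<lambda>k. distr M S (W (Suc k)))"
    by (subst (asm) indep_vars_iff_distr_eq_PiM) (auto simp: restrict_def)
  also have "\<dots> = Pi\<^sub>M UNIV (\<lambda>k. distr M S (W k))"
    using distr_eq by metis
  also have "\<dots> = distr M (Pi\<^sub>M UNIV (\<lambda>_. S)) (\<lambda>\<omega> k. W k \<omega>)"
    using indep by (subst (asm) indep_vars_iff_distr_eq_PiM) (auto simp: restrict_def)
  finally show ?thesis .
qed

end

section \<open>The maximal ergodic theorem and the maximal inequality\<close>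

context
  fixes M :: "'b measure" and V :: "nat \<Rightarrow> 'b \<Rightarrow> real"
  assumes iid: "iid_seq M borel V"
begin

interpretation iid_seq M borel V by (fact iid)

lemma maximal_ergodic:
  assumes int: "integrable M (V 0)"
  shows "0 \<le> (\<integral>\<omega>. V 0 \<omega> * indicator {\<omega>. max_psum (Suc n) (\<lambda>k. V k \<omega>) > 0} \<omega> \<partial>M)"
proof -
  have I: "integrable M (V k)" for k
    using int integrable_eq[of "\<lambda>x. x" k] by simp
  \<comment> \<open>Where \<open>?F (Suc n) > 0\<close> it equals \<open>V 0 + ?G n\<close>, and \<open>?G n\<close> has the same expectation as
    \<open>?F n \<le> ?F (Suc n)\<close>.\<close>
  let ?F = "\<lambda>n \<omega>. max_psum n (\<lambda>k. V k \<omega>)" and ?G = "\<lambda>n \<omega>. max_psum n (\<lambda>k. V (Suc k) \<omega>)"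
  have [simp]: "integrable M (?F n)" "integrable M (?G n)" for n
    by (intro integrable_max_psum I)+
  have "(\<integral>\<omega>. ?G n \<omega> \<partial>M) = (\<integral>w. max_psum n w \<partial>distr M (Pi\<^sub>M UNIV (\<lambda>_. borel)) (\<lambda>\<omega> k. V (Suc k) \<omega>))"
    by (subst integral_distr) (auto intro!: measurable_PiM_single' measurable_max_psum)
  also have "\<dots> = (\<integral>w. max_psum n w \<partial>distr M (Pi\<^sub>M UNIV (\<lambda>_. borel)) (\<lambda>\<omega> k. V k \<omega>))"
    by (simp only: distr_shift)
  also have "\<dots> = (\<integral>\<omega>. ?F n \<omega> \<partial>M)"
    by (subst integral_distr) (auto intro!: measurable_PiM_single' measurable_max_psum)
  finally have eq: "(\<integral>\<omega>. ?G n \<omega> \<partial>M) = (\<integral>\<omega>. ?F n \<omega> \<partial>M)" .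
  have "0 \<le> (\<integral>\<omega>. ?F (Suc n) \<omega> \<partial>M) - (\<integral>\<omega>. ?F n \<omega> \<partial>M)"
    by (simp del: max_psum.simps add: integral_mono max_psum_le_Suc)
  also have "\<dots> = (\<integral>\<omega>. ?F (Suc n) \<omega> - ?G n \<omega> \<partial>M)"
    by (simp add: eq del: max_psum.simps)
  also have "\<dots> \<le> (\<integral>\<omega>. V 0 \<omega> * indicator {\<omega>. ?F (Suc n) \<omega> > 0} \<omega> \<partial>M)"
  proof (rule integral_mono)
    have "(\<lambda>\<omega>. V 0 \<omega> * indicator {\<omega>. ?F (Suc n) \<omega> > 0} \<omega>)
        = (\<lambda>\<omega>. if ?F (Suc n) \<omega> > 0 then V 0 \<omega> else 0)"
      by (auto simp: fun_eq_iff indicator_def simp del: max_psum.simps)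
    moreover have [measurable]: "?F (Suc n) \<in> borel_measurable M" by (rule measurable_max_psum) simp
    ultimately have [measurable]: "(\<lambda>\<omega>. V 0 \<omega> * indicator {\<omega>. ?F (Suc n) \<omega> > 0} \<omega>) \<in> borel_measurable M"
      by (simp del: max_psum.simps)
    show "integrable M (\<lambda>\<omega>. V 0 \<omega> * indicator {\<omega>. ?F (Suc n) \<omega> > 0} \<omega>)"
      by (rule Bochner_Integration.integrable_bound[OF int]) (auto simp: indicator_def)
    \<comment> \<open>Off the set, \<open>?F (Suc n) \<omega>\<close> is 0 and the left side is
      \<open>- ?G n \<omega>\<close>, which is not positive.\<close>
    show "?F (Suc n) \<omega> - ?G n \<omega> \<le> V 0 \<omega> * indicator {\<omega>. ?F (Suc n) \<omega> > 0} \<omega>" for \<omega>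
      using max_psum_nonneg[of n "\<lambda>k. V (Suc k) \<omega>"] by (auto simp: indicator_def max_def)
  qed (simp del: max_psum.simps)
  finally show ?thesis .
qed

end

context iid_seq
begin

text \<open>Apply \<open>maximal_ergodic\<close> to \<open>h - l\<close>: on the event
  \<open>B n\<close> the integral of \<open>h\<close> is at least \<open>l\<close> times the
  probability of \<open>B n\<close>, and it is at most the full mean because \<open>h\<close> is
  nonnegative. The events \<open>B n\<close> increase to one that contains the event in question.
  The gain over Markov's inequality is that all n are controlled at once.\<close>

lemma maximal_inequality:
  fixes h :: "'c \<Rightarrow> real"
  assumes [measurable]: "h \<in> borel_measurable S" and nn: "\<And>x. h x \<ge> 0"
    and int: "integrable M (\<lambda>\<omega>. h (W 0 \<omega>))" and l: "l > 0"
  shows "prob {\<omega>\<in>space M. \<exists>n. (\<Sum>k<n. h (W k \<omega>)) > real n * l} \<le> (\<integral>\<omega>. h (W 0 \<omega>) \<partial>M) / l"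
proof -
  define V where "V k \<omega> = h (W k \<omega>) - l" for k \<omega>
  have iid: "iid_seq M borel V"
    unfolding V_def by (rule iid_seq_compose[where h="\<lambda>x. h x - l"]) simp
  have [measurable]: "V k \<in> borel_measurable M" for k unfolding V_def by simp
  define B where "B n = {\<omega>\<in>space M. max_psum (Suc n) (\<lambda>k. V k \<omega>) > 0}" for n
  have [measurable]: "(\<lambda>\<omega>. max_psum n (\<lambda>k. V k \<omega>)) \<in> borel_measurable M" for n
    by (rule measurable_max_psum) simp
  have [measurable]: "B n \<in> sets M" for n
    unfolding B_def by (simp del: max_psum.simps)
  have bound: "prob (B n) \<le> (\<integral>\<omega>. h (W 0 \<omega>) \<partial>M) / l" for n
  proof -
    have i: "integrable M (\<lambda>\<omega>. h (W 0 \<omega>) * indicator (B n) \<omega>)"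
      by (rule Bochner_Integration.integrable_bound[OF int]) (auto simp: indicator_def)
    have i2: "integrable M (\<lambda>\<omega>. l * indicator (B n) \<omega>)"
      by (intro integrable_mult_right integrable_real_indicator) (auto simp: emeasure_eq_measure)
    have "0 \<le> (\<integral>\<omega>. V 0 \<omega> * indicator {\<omega>. max_psum (Suc n) (\<lambda>k. V k \<omega>) > 0} \<omega> \<partial>M)"
      by (rule maximal_ergodic[OF iid]) (simp add: V_def[abs_def] int)
    also have "\<dots> = (\<integral>\<omega>. h (W 0 \<omega>) * indicator (B n) \<omega> - l * indicator (B n) \<omega> \<partial>M)"
      by (rule Bochner_Integration.integral_cong)
        (auto simp: B_def V_def indicator_def simp del: max_psum.simps)
    also have "\<dots> = (\<integral>\<omega>. h (W 0 \<omega>) * indicator (B n) \<omega> \<partial>M) - l * prob (B n)"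
      by (subst Bochner_Integration.integral_diff[OF i i2]) simp
    also have "(\<integral>\<omega>. h (W 0 \<omega>) * indicator (B n) \<omega> \<partial>M) \<le> (\<integral>\<omega>. h (W 0 \<omega>) \<partial>M)"
      by (rule integral_mono[OF i int]) (auto simp: indicator_def nn)
    finally show ?thesis using l by (simp add: field_simps)
  qed
  have "incseq B"
    by (rule incseq_SucI) (auto simp: B_def simp del: max_psum.simps intro: less_le_trans max_psum_le_Suc)
  then have "(\<lambda>n. prob (B n)) \<longlonglongrightarrow> prob (\<Union>n. B n)"
    by (intro finite_Lim_measure_incseq) auto
  then have "prob (\<Union>n. B n) \<le> (\<integral>\<omega>. h (W 0 \<omega>) \<partial>M) / l"
    using bound by (intro LIMSEQ_le_const2) auto
  moreover have "{\<omega>\<in>space M. \<exists>n. (\<Sum>k<n. h (W k \<omega>)) > real n * l} \<subseteq> (\<Union>n. B n)"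
  proof (intro subsetI, clarify)
    fix \<omega> n assume w: "\<omega> \<in> space M" and "real n * l < (\<Sum>k<n. h (W k \<omega>))"
    then have "0 < (\<Sum>k<n. V k \<omega>)"
      by (simp add: V_def sum_subtractf)
    also have "\<dots> \<le> max_psum (Suc n) (\<lambda>k. V k \<omega>)"
      by (rule psum_le_max_psum) simp
    finally show "\<omega> \<in> (\<Union>n. B n)" using w unfolding B_def by blast
  qed
  then have "prob {\<omega>\<in>space M. \<exists>n. (\<Sum>k<n. h (W k \<omega>)) > real n * l} \<le> prob (\<Union>n. B n)"
    by (intro finite_measure_mono) auto
  ultimately show ?thesis by linarith
qed

section \<open>From bounded to integrable variables\<close>

lemma strong_law_bounded:
  fixes h :: "'c \<Rightarrow> real"
  assumes [measurable]: "h \<in> borel_measurable S" and bd: "\<And>x. \<bar>h x\<bar> \<le> B"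
  shows "AE \<omega> in M. (\<lambda>n. (\<Sum>k<n. h (W k \<omega>)) / n) \<longlonglongrightarrow> (\<integral>\<omega>. h (W 0 \<omega>) \<partial>M)"
proof -
  \<comment> \<open>\<open>B\<close> may be 0; adding 1 keeps the interval from \<open>- C\<close>
    to \<open>C\<close> nondegenerate, which Hoeffding's inequality and \<open>q < 1\<close>
    require.\<close>
  define C where "C = B + 1"
  have C: "C > 0" "\<bar>h x\<bar> \<le> C" for x
    using bd[of undefined] bd[of x] by (auto simp: C_def)
  define \<mu> where "\<mu> = (\<integral>\<omega>. h (W 0 \<omega>) \<partial>M)"
  interpret h: iid_seq M borel "\<lambda>k \<omega>. h (W k \<omega>)"
    by (rule iid_seq_compose) simp
  have ev: "AE \<omega> in M. \<forall>\<^sub>F n in sequentially. \<bar>(\<Sum>k<n. h (W k \<omega>)) / n - \<mu>\<bar> < e" if "e > 0" for e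
  proof -
    define A where "A n = {\<omega>\<in>space M. \<bar>(\<Sum>k<n. h (W k \<omega>)) / n - \<mu>\<bar> \<ge> e}" for n :: nat
    define q where "q = exp (- 2 * e\<^sup>2 / (C - (- C))\<^sup>2)"
    have q: "0 < q" "q < 1" using \<open>e > 0\<close> C by (auto simp: q_def)
    have A [measurable]: "A n \<in> sets M" for n unfolding A_def by measurable
    have le: "prob (A n) \<le> 2 * q ^ n" if "n \<ge> 1" for n
    proof -
      interpret H: Hoeffding_ineq_iid M "{..<n}" "\<lambda>k \<omega>. h (W k \<omega>)" "\<lambda>\<omega>. h (W 0 \<omega>)" "- C" C \<mu>
      proof unfold_locales
        show "indep_vars (\<lambda>_. borel) (\<lambda>k \<omega>. h (W k \<omega>)) {..<n}"
          using h.indep by (rule indep_vars_subset) auto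
        show "AE x in M. h (W 0 x) \<in> {- C..C}"
          using C by (auto simp: abs_le_iff minus_le_iff)
      qed (auto simp: \<mu>_def intro: h.distr_eq)
      have "prob (A n) \<le> 2 * exp (-2 * card {..<n} * e\<^sup>2 / (C - (- C))\<^sup>2)"
        unfolding A_def using H.Hoeffding_ineq_abs_ge'[of e] \<open>e > 0\<close> C that
        by (simp only: card_lessThan lessThan_empty_iff) auto
      also have "\<dots> = 2 * q ^ n"
        by (simp add: q_def exp_of_nat_mult[symmetric] mult_ac)
      finally show ?thesis .
    qed
    have "summable (\<lambda>n. 2 * q ^ n)" using q by (intro summable_mult summable_geometric) auto
    then have "summable (\<lambda>n. prob (A n))"
      by (rule summable_comparison_test'[where N=1]) (use le in auto)
    then have "AE \<omega> in M. \<forall>\<^sub>F n in sequentially. \<omega> \<in> space M - A n"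
      by (intro borel_cantelli_AE1) (auto simp: emeasure_eq_measure)
    then show ?thesis
      by eventually_elim (auto simp: A_def elim!: eventually_mono)
  qed
  \<comment> \<open>Countably many tolerances suffice for convergence, so their null sets can be
    united.\<close>
  have "AE \<omega> in M. \<forall>j. \<forall>\<^sub>F n in sequentially. \<bar>(\<Sum>k<n. h (W k \<omega>)) / n - \<mu>\<bar> < 1 / real (Suc j)"
    unfolding AE_all_countable by (intro allI ev) simp
  then show ?thesis unfolding \<mu>_def[symmetric]
  proof eventually_elim
    case (elim \<omega>)
    show ?case
    proof (rule tendstoI)
      fix e :: real assume "e > 0"
      then obtain j where "1 / real (Suc j) < e" by (rule nat_approx_posE)
      with elim[rule_format, of j]
      show "\<forall>\<^sub>F n in sequentially. dist ((\<Sum>k<n. h (W k \<omega>)) / n) \<mu> < e"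
        by (elim eventually_mono) (simp add: dist_real_def)
    qed
  qed
qed

text \<open>For a fixed tolerance the bad event \<open>B\<close> does not depend on the truncation
  level m. Its probability is at most the mean of the remainder \<open>R m\<close> divided by the
  tolerance for all large m, and these means tend to 0 by dominated convergence, so \<open>B\<close>
  is null.\<close>

lemma strong_law:
  fixes h :: "'c \<Rightarrow> real"
  assumes [measurable]: "h \<in> borel_measurable S" and int: "integrable M (\<lambda>\<omega>. h (W 0 \<omega>))"
  shows "AE \<omega> in M. (\<lambda>n. (\<Sum>k<n. h (W k \<omega>)) / n) \<longlonglongrightarrow> (\<integral>\<omega>. h (W 0 \<omega>) \<partial>M)"
proof -
  define \<mu> where "\<mu> = (\<integral>\<omega>. h (W 0 \<omega>) \<partial>M)"
  define T where "T m x = (if \<bar>h x\<bar> \<le> real m then h x else 0)" for m x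
  define R where "R m x = \<bar>h x - T m x\<bar>" for m x
  have [measurable]: "T m \<in> borel_measurable S" "R m \<in> borel_measurable S" for m
    unfolding T_def R_def by auto
  have intT: "integrable M (\<lambda>\<omega>. T m (W 0 \<omega>))" for m
    by (rule Bochner_Integration.integrable_bound[OF int]) (auto simp: T_def)
  have intR: "integrable M (\<lambda>\<omega>. R m (W 0 \<omega>))" for m
    unfolding R_def by (intro integrable_abs Bochner_Integration.integrable_diff int intT)
  have R0: "(\<lambda>m. \<integral>\<omega>. R m (W 0 \<omega>) \<partial>M) \<longlonglongrightarrow> (\<integral>\<omega>. 0 \<partial>M)"
  proof (rule integral_dominated_convergence)
    show "integrable M (\<lambda>\<omega>. \<bar>h (W 0 \<omega>)\<bar>)" using int by simp
    show "AE \<omega> in M. (\<lambda>m. R m (W 0 \<omega>)) \<longlonglongrightarrow> 0"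
    proof (rule AE_I2)
      fix \<omega>
      have "\<forall>\<^sub>F m in sequentially. \<bar>h (W 0 \<omega>)\<bar> \<le> real m"
        using eventually_ge_at_top[of "nat \<lceil>\<bar>h (W 0 \<omega>)\<bar>\<rceil>"] by eventually_elim linarith
      then have "\<forall>\<^sub>F m in sequentially. R m (W 0 \<omega>) = 0"
        by eventually_elim (simp add: R_def T_def)
      then show "(\<lambda>m. R m (W 0 \<omega>)) \<longlonglongrightarrow> 0" by (rule tendsto_eventually)
    qed
  qed (auto simp: R_def T_def)
  have "AE \<omega> in M. (\<lambda>n. (\<Sum>k<n. T m (W k \<omega>)) / n) \<longlonglongrightarrow> (\<integral>\<omega>. T m (W 0 \<omega>) \<partial>M)" for m
    by (rule strong_law_bounded[where B="real m"]) (auto simp: T_def)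
  then have AET: "AE \<omega> in M. \<forall>m. (\<lambda>n. (\<Sum>k<n. T m (W k \<omega>)) / n) \<longlonglongrightarrow> (\<integral>\<omega>. T m (W 0 \<omega>) \<partial>M)"
    by (simp add: AE_all_countable)
  \<comment> \<open>One \<open>e\<close> each pays for replacing \<open>h\<close> by
    \<open>T m\<close> in the average, for the fluctuation of the average of \<open>T m\<close>, and
    for the difference of the two expectations.\<close>
  have ev: "AE \<omega> in M. \<forall>\<^sub>F n in sequentially. \<bar>(\<Sum>k<n. h (W k \<omega>)) / n - \<mu>\<bar> < 3 * e" if e: "e > 0" for e
  proof -
    define B where "B = {\<omega>\<in>space M. \<not> (\<forall>\<^sub>F n in sequentially. \<bar>(\<Sum>k<n. h (W k \<omega>)) / n - \<mu>\<bar> < 3 * e)}"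
    have B [measurable]: "B \<in> sets M" unfolding B_def by measurable
    have "prob B \<le> (\<integral>\<omega>. R m (W 0 \<omega>) \<partial>M) / e" if m: "(\<integral>\<omega>. R m (W 0 \<omega>) \<partial>M) < e" for m
    proof -
      let ?D = "{\<omega>\<in>space M. \<exists>n. (\<Sum>k<n. R m (W k \<omega>)) > real n * e}"
      have "\<bar>(\<integral>\<omega>. T m (W 0 \<omega>) \<partial>M) - \<mu>\<bar> = \<bar>\<integral>\<omega>. h (W 0 \<omega>) - T m (W 0 \<omega>) \<partial>M\<bar>"
        unfolding \<mu>_def by (subst Bochner_Integration.integral_diff[OF int intT]) simp
      also have "\<dots> \<le> (\<integral>\<omega>. R m (W 0 \<omega>) \<partial>M)" unfolding R_def by (rule integral_abs_bound)
      finally have mu: "\<bar>(\<integral>\<omega>. T m (W 0 \<omega>) \<partial>M) - \<mu>\<bar> < e" using m by simp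
      \<comment> \<open>Outside \<open>?D\<close> the averages of \<open>R m\<close> are at most
        \<open>e\<close> for every n simultaneously, so \<open>B\<close> lies in \<open>?D\<close>
        up to the null set of \<open>AET\<close>.\<close>
      have "AE \<omega> in M. \<omega> \<in> B \<longrightarrow> \<omega> \<in> ?D"
        using AET
      proof eventually_elim
        case (elim \<omega>)
        show ?case
        proof (intro impI, rule ccontr)
          assume wB: "\<omega> \<in> B" and nD: "\<omega> \<notin> ?D"
          then have le: "(\<Sum>k<n. R m (W k \<omega>)) \<le> real n * e" for n
            by (auto simp: B_def not_less)
          have "\<forall>\<^sub>F n in sequentially. dist ((\<Sum>k<n. T m (W k \<omega>)) / n) (\<integral>\<omega>. T m (W 0 \<omega>) \<partial>M) < e"
            using elim e by (auto dest!: spec[of _ m] tendstoD)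
          then have "\<forall>\<^sub>F n in sequentially. \<bar>(\<Sum>k<n. h (W k \<omega>)) / n - \<mu>\<bar> < 3 * e"
            using eventually_gt_at_top[of 0]
          proof eventually_elim
            case (elim n)
            have "\<bar>(\<Sum>k<n. h (W k \<omega>)) / n - (\<Sum>k<n. T m (W k \<omega>)) / n\<bar>
                = \<bar>\<Sum>k<n. h (W k \<omega>) - T m (W k \<omega>)\<bar> / n"
              by (simp add: sum_subtractf diff_divide_distrib[symmetric])
            also have "\<dots> \<le> (\<Sum>k<n. R m (W k \<omega>)) / n"
              unfolding R_def by (intro divide_right_mono sum_abs) simp
            also have "\<dots> \<le> e" using le[of n] elim by (simp add: field_simps)
            finally show ?case using elim mu unfolding dist_real_def by linarith
          qed
          then show False using wB by (simp add: B_def)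
        qed
      qed
      then have "prob B \<le> prob ?D"
        by (intro finite_measure_mono_AE) auto
      also have "\<dots> \<le> (\<integral>\<omega>. R m (W 0 \<omega>) \<partial>M) / e"
        by (rule maximal_inequality) (auto simp: R_def[symmetric] intR e, simp add: R_def)
      finally show ?thesis .
    qed
    moreover have "\<forall>\<^sub>F m in sequentially. (\<integral>\<omega>. R m (W 0 \<omega>) \<partial>M) < e"
      using order_tendstoD(2)[OF R0, of e] e by simp
    ultimately have "\<forall>\<^sub>F m in sequentially. prob B \<le> (\<integral>\<omega>. R m (W 0 \<omega>) \<partial>M) / e"
      by (auto elim: eventually_mono)
    moreover have "(\<lambda>m. (\<integral>\<omega>. R m (W 0 \<omega>) \<partial>M) / e) \<longlonglongrightarrow> 0"
      using tendsto_divide[OF R0 tendsto_const[of e]] e by simp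
    ultimately have "prob B \<le> 0"
      by (intro tendsto_lowerbound[where F=sequentially]) auto
    then have "AE \<omega> in M. \<omega> \<notin> B"
      by (subst AE_iff_measurable[of B]) (auto simp: emeasure_eq_measure B measure_le_0_iff dest: sets.sets_into_space[OF B, THEN subsetD])
    then show ?thesis using AE_space by eventually_elim (simp add: B_def)
  qed
  have "AE \<omega> in M. \<forall>j. \<forall>\<^sub>F n in sequentially. \<bar>(\<Sum>k<n. h (W k \<omega>)) / n - \<mu>\<bar> < 3 * (1 / real (Suc j))"
    unfolding AE_all_countable by (intro allI ev) simp
  then show ?thesis unfolding \<mu>_def[symmetric]
  proof eventually_elim
    case (elim \<omega>)
    show ?case
    proof (rule tendstoI)
      fix e :: real assume "e > 0"
      then obtain j where "1 / real (Suc j) < e / 3" by (metis nat_approx_posE divide_pos_pos zero_less_numeral)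
      with elim[rule_format, of j]
      show "\<forall>\<^sub>F n in sequentially. dist ((\<Sum>k<n. h (W k \<omega>)) / n) \<mu> < e"
        by (elim eventually_mono) (simp add: dist_real_def)
    qed
  qed
qed

end

section \<open>The strong law for almost every parameter\<close>

context iid_seq
begin

text \<open>For each fixed s the strong law leaves a null set of outcomes that depends on s. Joint
  measurability makes the set of pairs with convergence measurable, and Fubini then exchanges the
  two quantifiers: one null set of outcomes, outside of which only a null set of parameters is
  lost.\<close>

lemma strong_law_AE_parameter_real:
  fixes H :: "'p \<Rightarrow> 'c \<Rightarrow> real"
  assumes "sigma_finite_measure Q"
    and H [measurable]: "(\<lambda>s. H (fst s) (snd s)) \<in> borel_measurable (Q \<Otimes>\<^sub>M S)"
    and bd: "\<And>s x. \<bar>H s x\<bar> \<le> B"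
  shows "AE \<omega> in M. AE s in Q. (\<lambda>n. (\<Sum>k<n. H s (W k \<omega>)) / n) \<longlonglongrightarrow> (\<integral>\<omega>. H s (W 0 \<omega>) \<partial>M)"
proof -
  interpret Q: sigma_finite_measure Q by fact
  interpret P: pair_sigma_finite Q M ..
  have [measurable]: "(\<lambda>s. H (fst s) (W k (snd s))) \<in> borel_measurable (Q \<Otimes>\<^sub>M M)" for k
    using measurable_compose[of "\<lambda>s. (fst s, W k (snd s))" "Q \<Otimes>\<^sub>M M" "Q \<Otimes>\<^sub>M S", OF _ H] by simp
  have [measurable]: "(\<lambda>s. \<integral>\<omega>. H (fst s) (W 0 \<omega>) \<partial>M) \<in> borel_measurable (Q \<Otimes>\<^sub>M M)"
  proof -
    have "(\<lambda>s. \<integral>\<omega>. H s (W 0 \<omega>) \<partial>M) \<in> borel_measurable Q"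
      by (rule borel_measurable_lebesgue_integral) (simp add: case_prod_beta')
    then show ?thesis by (rule measurable_compose[OF measurable_fst])
  qed
  have "AE s in Q. AE \<omega> in M. (\<lambda>n. (\<Sum>k<n. H s (W k \<omega>)) / n) \<longlonglongrightarrow> (\<integral>\<omega>. H s (W 0 \<omega>) \<partial>M)"
  proof (rule AE_I2)
    fix s assume s: "s \<in> space Q"
    have "(\<lambda>x. H s x) \<in> borel_measurable S"
      using measurable_compose[OF measurable_Pair1'[OF s] H] by simp
    then show "AE \<omega> in M. (\<lambda>n. (\<Sum>k<n. H s (W k \<omega>)) / n) \<longlonglongrightarrow> (\<integral>\<omega>. H s (W 0 \<omega>) \<partial>M)"
      by (rule strong_law_bounded) (rule bd)
  qed
  then show ?thesis
    by (subst (asm) P.AE_commute) measurable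
qed

lemma strong_law_AE_parameter:
  fixes H :: "'p \<Rightarrow> 'c \<Rightarrow> complex"
  assumes Q: "sigma_finite_measure Q"
    and [measurable]: "(\<lambda>s. H (fst s) (snd s)) \<in> borel_measurable (Q \<Otimes>\<^sub>M S)"
    and bd: "\<And>s x. cmod (H s x) \<le> B"
  shows "AE \<omega> in M. AE s in Q. (\<lambda>n. (\<Sum>k<n. H s (W k \<omega>)) / of_nat n) \<longlonglongrightarrow> (\<integral>\<omega>. H s (W 0 \<omega>) \<partial>M)"
proof -
  have "AE \<omega> in M. AE s in Q. (\<lambda>n. (\<Sum>k<n. Re (H s (W k \<omega>))) / n) \<longlonglongrightarrow> (\<integral>\<omega>. Re (H s (W 0 \<omega>)) \<partial>M)"
    by (rule strong_law_AE_parameter_real[OF Q]) (auto intro: order_trans[OF abs_Re_le_cmod bd])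
  moreover have "AE \<omega> in M. AE s in Q. (\<lambda>n. (\<Sum>k<n. Im (H s (W k \<omega>))) / n) \<longlonglongrightarrow> (\<integral>\<omega>. Im (H s (W 0 \<omega>)) \<partial>M)"
    by (rule strong_law_AE_parameter_real[OF Q]) (auto intro: order_trans[OF abs_Im_le_cmod bd])
  ultimately show ?thesis
  proof eventually_elim
    case (elim \<omega>)
    show ?case using elim AE_space
    proof eventually_elim
      case (elim s)
      have "(\<lambda>x. H s x) \<in> borel_measurable S"
        using measurable_compose[OF measurable_Pair1'[OF elim(3)], of "\<lambda>s. H (fst s) (snd s)" S borel] by simp
      then have "integrable M (\<lambda>\<omega>. H s (W 0 \<omega>))"
        by (intro integrable_const_bound[where B=B]) (auto simp: bd)
      with elim show ?case
        by (simp add: tendsto_complex_iff integral_Re integral_Im Re_divide_of_nat Im_divide_of_nat)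
    qed
  qed
qed

end

subsection \<open>Dominated convergence and the dominating function\<close>

text \<open>Pratt's lemma: the dominating functions may vary as long as their integrals converge.\<close>

lemma nn_integral_dominated_convergence_general:
  fixes f g :: "nat \<Rightarrow> 'a \<Rightarrow> ennreal"
  assumes [measurable]: "\<And>n. f n \<in> borel_measurable M" "f' \<in> borel_measurable M"
    "\<And>n. g n \<in> borel_measurable M" "g' \<in> borel_measurable M"
  assumes le: "\<And>n x. x \<in> space M \<Longrightarrow> f n x \<le> g n x"
    and f: "AE x in M. (\<lambda>n. f n x) \<longlonglongrightarrow> f' x" and g: "AE x in M. (\<lambda>n. g n x) \<longlonglongrightarrow> g' x"
    and lim: "(\<lambda>n. \<integral>\<^sup>+x. g n x \<partial>M) \<longlonglongrightarrow> (\<integral>\<^sup>+x. g' x \<partial>M)" and fin: "(\<integral>\<^sup>+x. g' x \<partial>M) < \<infinity>"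
  shows "(\<lambda>n. \<integral>\<^sup>+x. f n x \<partial>M) \<longlonglongrightarrow> (\<integral>\<^sup>+x. f' x \<partial>M)"
proof -
  have le': "AE x in M. f' x \<le> g' x"
    using f g AE_space
    by eventually_elim (rule LIMSEQ_le, auto intro: le)
  \<comment> \<open>Cutting \<open>f n\<close> off at \<open>g'\<close> gives sequences with the
    fixed integrable bound \<open>g'\<close>, to which ordinary dominated convergence applies. What
    is cut off is controlled below by the excess of \<open>g n\<close> over
    \<open>g'\<close>.\<close>
  have min_f: "(\<lambda>n. \<integral>\<^sup>+x. min (f n x) (g' x) \<partial>M) \<longlonglongrightarrow> (\<integral>\<^sup>+x. f' x \<partial>M)"
  proof (rule nn_integral_dominated_convergence[where w=g'])
    show "AE x in M. (\<lambda>n. min (f n x) (g' x)) \<longlonglongrightarrow> f' x"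
      using f le'
    proof eventually_elim
      case (elim x)
      then have "(\<lambda>n. min (f n x) (g' x)) \<longlonglongrightarrow> min (f' x) (g' x)" by (intro tendsto_intros)
      with elim show ?case by (simp add: min_absorb1)
    qed
  qed (use fin in auto)
  have min_g: "(\<lambda>n. \<integral>\<^sup>+x. min (g n x) (g' x) \<partial>M) \<longlonglongrightarrow> (\<integral>\<^sup>+x. g' x \<partial>M)"
  proof (rule nn_integral_dominated_convergence[where w=g'])
    show "AE x in M. (\<lambda>n. min (g n x) (g' x)) \<longlonglongrightarrow> g' x"
      using g
    proof eventually_elim
      case (elim x)
      then have "(\<lambda>n. min (g n x) (g' x)) \<longlonglongrightarrow> min (g' x) (g' x)" by (intro tendsto_intros)
      then show ?case by simp
    qed
  qed (use fin in auto)
  have min_fin: "(\<integral>\<^sup>+x. min (g n x) (g' x) \<partial>M) \<noteq> \<infinity>" for n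
  proof -
    have "(\<integral>\<^sup>+x. min (g n x) (g' x) \<partial>M) \<le> (\<integral>\<^sup>+x. g' x \<partial>M)" by (intro nn_integral_mono) simp
    with fin show ?thesis by (auto simp: top_unique)
  qed
  \<comment> \<open>Subtraction in [0, infinity] commutes with the integral because the subtracted
    integral is finite. The two integrals on the right have the same finite limit, so the excess
    vanishes in the limit.\<close>
  have diff: "(\<integral>\<^sup>+x. g n x - min (g n x) (g' x) \<partial>M) = (\<integral>\<^sup>+x. g n x \<partial>M) - (\<integral>\<^sup>+x. min (g n x) (g' x) \<partial>M)" for n
    by (rule nn_integral_diff) (use min_fin in auto)
  have "(\<lambda>n. \<integral>\<^sup>+x. g n x - min (g n x) (g' x) \<partial>M) \<longlonglongrightarrow> (\<integral>\<^sup>+x. g' x \<partial>M) - (\<integral>\<^sup>+x. g' x \<partial>M)"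
    unfolding diff by (rule tendsto_diff_ennreal[OF lim min_g]) (use fin in auto)
  then have "(\<lambda>n. (\<integral>\<^sup>+x. min (f n x) (g' x) \<partial>M) + (\<integral>\<^sup>+x. g n x - min (g n x) (g' x) \<partial>M))
      \<longlonglongrightarrow> (\<integral>\<^sup>+x. f' x \<partial>M) + ((\<integral>\<^sup>+x. g' x \<partial>M) - (\<integral>\<^sup>+x. g' x \<partial>M))"
    by (intro tendsto_add min_f)
  then have upper: "(\<lambda>n. (\<integral>\<^sup>+x. min (f n x) (g' x) \<partial>M) + (\<integral>\<^sup>+x. g n x - min (g n x) (g' x) \<partial>M))
      \<longlonglongrightarrow> (\<integral>\<^sup>+x. f' x \<partial>M)"
    using fin by simp
  show ?thesis
  proof (rule tendsto_sandwich[OF _ _ min_f upper]; intro always_eventually allI)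
    fix n
    show "(\<integral>\<^sup>+x. min (f n x) (g' x) \<partial>M) \<le> (\<integral>\<^sup>+x. f n x \<partial>M)"
      by (intro nn_integral_mono) simp
    \<comment> \<open>If \<open>f n x\<close> exceeds \<open>g' x\<close>, the bound on the right
      becomes \<open>g' x + (g n x - g' x) = g n x\<close>, which dominates
      \<open>f n x\<close>.\<close>
    have "(\<integral>\<^sup>+x. f n x \<partial>M) \<le> (\<integral>\<^sup>+x. min (f n x) (g' x) + (g n x - min (g n x) (g' x)) \<partial>M)"
    proof (rule nn_integral_mono)
      fix x assume "x \<in> space M"
      then have "f n x \<le> g n x" by (rule le)
      show "f n x \<le> min (f n x) (g' x) + (g n x - min (g n x) (g' x))"
      proof (cases "f n x \<le> g' x")
        case True
        then show ?thesis by (simp add: min_absorb1)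
      next
        case False
        then have "g' x \<le> f n x" by simp
        moreover from \<open>g' x \<le> f n x\<close> \<open>f n x \<le> g n x\<close> have "g' x \<le> g n x" by (rule order_trans)
        then have "g' x + (g n x - g' x) = g n x" by (rule add_diff_inverse_ennreal)
        ultimately show ?thesis using \<open>f n x \<le> g n x\<close> by (simp only: min_absorb2)
      qed
    qed
    also have "\<dots> = (\<integral>\<^sup>+x. min (f n x) (g' x) \<partial>M) + (\<integral>\<^sup>+x. g n x - min (g n x) (g' x) \<partial>M)"
      by (rule nn_integral_add) auto
    finally show "(\<integral>\<^sup>+x. f n x \<partial>M) \<le> \<dots>" .
  qed
qed

section \<open>Product integrands and the bound on empirical covariances\<close>

lemma nn_integral_pair_product:
  fixes f :: "'a \<Rightarrow> real" and g :: "'b \<Rightarrow> real"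
  assumes "sigma_finite_measure N"
    and f: "integrable M f" "\<And>x. f x \<ge> 0" and g: "integrable N g" "\<And>x. g x \<ge> 0"
  shows "(\<integral>\<^sup>+s. ennreal (f (fst s) * g (snd s)) \<partial>(M \<Otimes>\<^sub>M N)) = ennreal ((\<integral>x. f x \<partial>M) * (\<integral>x. g x \<partial>N))"
proof -
  interpret sigma_finite_measure N by fact
  have [measurable]: "f \<in> borel_measurable M" "g \<in> borel_measurable N" using f g by auto
  have "(\<integral>\<^sup>+s. ennreal (f (fst s) * g (snd s)) \<partial>(M \<Otimes>\<^sub>M N))
      = (\<integral>\<^sup>+x. \<integral>\<^sup>+y. ennreal (f x * g y) \<partial>N \<partial>M)"
    by (subst nn_integral_fst[symmetric]) auto
  also have "\<dots> = (\<integral>\<^sup>+x. ennreal (f x) * (\<integral>\<^sup>+y. ennreal (g y) \<partial>N) \<partial>M)"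
    by (simp add: ennreal_mult f g nn_integral_cmult)
  also have "\<dots> = (\<integral>\<^sup>+x. ennreal (f x) \<partial>M) * (\<integral>\<^sup>+y. ennreal (g y) \<partial>N)"
    by (rule nn_integral_multc) simp
  also have "\<dots> = ennreal ((\<integral>x. f x \<partial>M) * (\<integral>x. g x \<partial>N))"
    using f g by (simp add: nn_integral_eq_integral ennreal_mult Bochner_Integration.integral_nonneg)
  finally show ?thesis .
qed

lemma mean_product_le:
  fixes x y :: "nat \<Rightarrow> real"
  shows "((\<Sum>k\<in>K. x k * y k) / real n)\<^sup>2 \<le> ((\<Sum>k\<in>K. (x k)\<^sup>2) / real n) * ((\<Sum>k\<in>K. (y k)\<^sup>2) / real n)"
  using Cauchy_Schwarz_ineq_sum[of x y K]
  by (simp add: power_divide divide_right_mono power2_eq_square)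

text \<open>The left side is the squared modulus of an empirical covariance. The bound separates
  \<alpha> from \<beta>, so that after inserting the weight its integral over pairs is a product.
  For \<open>n = 0\<close> every quotient is 0.\<close>

lemma emp_covariance_bound:
  fixes \<alpha> \<beta> :: "nat \<Rightarrow> real"
  shows "(cmod ((\<Sum>k=1..n. iexp (\<alpha> k + \<beta> k)) / of_nat n
      - (\<Sum>k=1..n. iexp (\<alpha> k)) / of_nat n * ((\<Sum>k=1..n. iexp (\<beta> k)) / of_nat n)))\<^sup>2
    \<le> 16 * ((\<Sum>k=1..n. 1 - cos (\<alpha> k)) / real n) * ((\<Sum>k=1..n. 1 - cos (\<beta> k)) / real n)"
proof (cases "n = 0")
  case False
  \<comment> \<open>Covariances do not change when \<open>1\<close> is subtracted from both variables.\<close>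
  define a b where "a k = iexp (\<alpha> k) - 1" and "b k = iexp (\<beta> k) - 1" for k
  define P Q where "P = (\<Sum>k=1..n. (cmod (a k))\<^sup>2) / real n" and "Q = (\<Sum>k=1..n. (cmod (b k))\<^sup>2) / real n"
  have sq: "(cmod (iexp t - 1))\<^sup>2 = 2 * (1 - cos t)" for t :: real
    using sin_cos_squared_add[of t]
    unfolding cmod_power2 by (simp add: Re_exp Im_exp power2_eq_square algebra_simps)
  have P: "P = 2 * ((\<Sum>k=1..n. 1 - cos (\<alpha> k)) / real n)" and Q: "Q = 2 * ((\<Sum>k=1..n. 1 - cos (\<beta> k)) / real n)"
    unfolding P_def Q_def a_def b_def sq sum_distrib_left[symmetric] by auto
  have PQ: "P \<ge> 0" "Q \<ge> 0" by (auto simp: P_def Q_def intro!: sum_nonneg divide_nonneg_nonneg)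
  \<comment> \<open>Jensen's inequality for the square, as Cauchy-Schwarz against the constant 1;
    \<open>n\<close> being nonzero makes the mean of the constant equal to 1.\<close>
  have mean: "(cmod ((\<Sum>k=1..n. c k) / of_nat n))\<^sup>2 \<le> (\<Sum>k=1..n. (cmod (c k))\<^sup>2) / real n" for c :: "nat \<Rightarrow> complex"
  proof -
    have "cmod ((\<Sum>k=1..n. c k) / of_nat n) \<le> (\<Sum>k=1..n. cmod (c k) * 1) / real n"
      by (simp add: norm_divide divide_right_mono norm_sum)
    then have "(cmod ((\<Sum>k=1..n. c k) / of_nat n))\<^sup>2 \<le> ((\<Sum>k=1..n. cmod (c k) * 1) / real n)\<^sup>2"
      by (intro power_mono) auto
    also have "\<dots> \<le> (\<Sum>k=1..n. (cmod (c k))\<^sup>2) / real n * ((\<Sum>k=1..n. 1\<^sup>2) / real n)"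
      by (rule mean_product_le)
    finally show ?thesis using False by simp
  qed
  have 1: "(cmod ((\<Sum>k=1..n. a k * b k) / of_nat n))\<^sup>2 \<le> P * Q"
  proof -
    have "cmod ((\<Sum>k=1..n. a k * b k) / of_nat n) \<le> (\<Sum>k=1..n. cmod (a k) * cmod (b k)) / real n"
      using norm_sum[of "\<lambda>k. a k * b k" "{1..n}"] by (simp add: norm_divide divide_right_mono norm_mult)
    then have "(cmod ((\<Sum>k=1..n. a k * b k) / of_nat n))\<^sup>2 \<le> ((\<Sum>k=1..n. cmod (a k) * cmod (b k)) / real n)\<^sup>2"
      by (intro power_mono) auto
    also have "\<dots> \<le> P * Q" unfolding P_def Q_def by (rule mean_product_le)
    finally show ?thesis .
  qed
  have 2: "(cmod ((\<Sum>k=1..n. a k) / of_nat n * ((\<Sum>k=1..n. b k) / of_nat n)))\<^sup>2 \<le> P * Q"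
    unfolding norm_mult power_mult_distrib P_def Q_def
    by (intro mult_mono mean) (auto intro!: sum_nonneg divide_nonneg_nonneg)
  have ab: "iexp (\<alpha> k) = a k + 1" "iexp (\<beta> k) = b k + 1" for k by (simp_all add: a_def b_def)
  have "(\<Sum>k=1..n. iexp (\<alpha> k + \<beta> k)) / of_nat n
      - (\<Sum>k=1..n. iexp (\<alpha> k)) / of_nat n * ((\<Sum>k=1..n. iexp (\<beta> k)) / of_nat n)
    = (\<Sum>k=1..n. (a k + 1) * (b k + 1)) / of_nat n
      - (\<Sum>k=1..n. a k + 1) / of_nat n * ((\<Sum>k=1..n. b k + 1) / of_nat n)"
    by (simp add: distrib_left exp_add ab)
  also have "\<dots> = (\<Sum>k=1..n. a k * b k) / of_nat n
      - (\<Sum>k=1..n. a k) / of_nat n * ((\<Sum>k=1..n. b k) / of_nat n)"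
    using False by (simp add: algebra_simps sum.distrib add_divide_distrib)
  finally have "(cmod ((\<Sum>k=1..n. iexp (\<alpha> k + \<beta> k)) / of_nat n
      - (\<Sum>k=1..n. iexp (\<alpha> k)) / of_nat n * ((\<Sum>k=1..n. iexp (\<beta> k)) / of_nat n)))\<^sup>2
    \<le> (cmod ((\<Sum>k=1..n. a k * b k) / of_nat n)
      + cmod ((\<Sum>k=1..n. a k) / of_nat n * ((\<Sum>k=1..n. b k) / of_nat n)))\<^sup>2"
    by (simp only:) (intro power_mono norm_triangle_ineq4 norm_ge_zero)
  \<comment> \<open>Both squares are at most \<open>P * Q\<close>, and the square of a sum is at
    most twice the sum of the squares. The remaining factor 4 of 16 comes from the factors 2 in
    \<open>P\<close> and \<open>Q\<close>.\<close>
  also have "\<dots> \<le> 4 * (P * Q)"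
    using 1 2 sum_squares_bound[of "cmod ((\<Sum>k=1..n. a k * b k) / of_nat n)"
        "cmod ((\<Sum>k=1..n. a k) / of_nat n * ((\<Sum>k=1..n. b k) / of_nat n))"]
    unfolding power2_sum by linarith
  also have "\<dots> = 16 * ((\<Sum>k=1..n. 1 - cos (\<alpha> k)) / real n) * ((\<Sum>k=1..n. 1 - cos (\<beta> k)) / real n)"
    unfolding P Q by simp
  finally show ?thesis .
qed simp

subsection \<open>The cosine kernel\<close>

lemma one_minus_cos_le: "1 - cos (x::real) \<le> x\<^sup>2 / 2"
proof -
  have "1 - cos x = 2 * (sin (x / 2))\<^sup>2"
    using cos_double_sin[of "x / 2"] by simp
  also have "(sin (x / 2))\<^sup>2 \<le> (x / 2)\<^sup>2"
    using abs_sin_x_le_abs_x[of "x / 2"] by (simp only: abs_le_square_iff)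
  finally show ?thesis by (simp add: power_divide)
qed

section \<open>Lebesgue measure and measurability on coordinate spaces\<close>

lemma finite_product_sigma_finite_lborel: "finite A \<Longrightarrow> finite_product_sigma_finite (\<lambda>_. lborel :: real measure) A"
  by unfold_locales (auto intro: sigma_finite_measure.sigma_finite_countable)

lemma sigma_finite_leb_on: "finite A \<Longrightarrow> sigma_finite_measure (leb_on A)"
  unfolding leb_on_def
  by (intro product_sigma_finite.sigma_finite product_sigma_finite.intro lborel.sigma_finite_measure_axioms)

lemma measurable_leb_on_component: "i \<in> A \<Longrightarrow> (\<lambda>x. x i) \<in> borel_measurable (leb_on A)"
  unfolding leb_on_def using measurable_component_singleton[of i A "\<lambda>_. lborel"] by simp

lemma measurable_inner_on:
  assumes "\<And>i. i \<in> A \<Longrightarrow> (\<lambda>x. f x i) \<in> borel_measurable M" "\<And>i. i \<in> A \<Longrightarrow> (\<lambda>x. g x i) \<in> borel_measurable M"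
  shows "(\<lambda>x. inner_on A (f x) (g x)) \<in> borel_measurable M"
  unfolding inner_on_def using assms by (intro borel_measurable_sum borel_measurable_times)

lemma measurable_L2_set:
  assumes "\<And>i. i \<in> A \<Longrightarrow> (\<lambda>x. f x i) \<in> borel_measurable M"
  shows "(\<lambda>x. L2_set (f x) A) \<in> borel_measurable M"
  unfolding L2_set_def using assms by (intro borel_measurable_sqrt[THEN measurable_compose_rev] borel_measurable_sum borel_measurable_power) auto

lemma measurable_L2_set_leb_on [measurable]: "(\<lambda>u. L2_set u A) \<in> borel_measurable (leb_on A)"
  by (intro measurable_L2_set measurable_leb_on_component)

lemma measurable_inner_on_leb_on [measurable]: "(\<lambda>u. inner_on A u y) \<in> borel_measurable (leb_on A)"
  by (intro measurable_inner_on measurable_leb_on_component) auto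

lemma abs_inner_on_le: "\<bar>inner_on A u y\<bar> \<le> L2_set u A * L2_set y A"
proof -
  have "\<bar>inner_on A u y\<bar> \<le> (\<Sum>i\<in>A. \<bar>u i\<bar> * \<bar>y i\<bar>)"
    unfolding inner_on_def using sum_abs[of "\<lambda>i. u i * y i" A] by (simp add: abs_mult)
  then show ?thesis using L2_set_mult_ineq[of u y A] by linarith
qed

text \<open>The ball lies in a cube of side \<open>2 * r\<close>. Only the order of growth in
  \<open>r\<close> matters for the kernel estimate, not the exact volume.\<close>

lemma emeasure_leb_on_ball:
  assumes "finite A" "r \<ge> 0"
  shows "emeasure (leb_on A) {u\<in>space (leb_on A). L2_set u A \<le> r} \<le> ennreal ((2 * r) ^ card A)"
proof -
  interpret finite_product_sigma_finite "\<lambda>_. lborel :: real measure" A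
    by (rule finite_product_sigma_finite_lborel) fact
  have "{u\<in>space (leb_on A). L2_set u A \<le> r} \<subseteq> Pi\<^sub>E A (\<lambda>_. {-r..r})"
  proof (clarsimp simp: leb_on_def space_PiM)
    fix u assume u: "u \<in> A \<rightarrow>\<^sub>E (UNIV :: real set)" and le: "L2_set u A \<le> r"
    have "\<bar>u i\<bar> \<le> r" if "i \<in> A" for i
    proof -
      have "\<bar>u i\<bar> \<le> L2_set (\<lambda>i. \<bar>u i\<bar>) A" using \<open>finite A\<close> that by (rule member_le_L2_set)
      with le show ?thesis by (simp add: L2_set_def)
    qed
    with u show "u \<in> A \<rightarrow>\<^sub>E {-r..r}" by (auto simp: PiE_iff abs_le_iff minus_le_iff)
  qed
  then have "emeasure (leb_on A) {u\<in>space (leb_on A). L2_set u A \<le> r} \<le> emeasure (leb_on A) (Pi\<^sub>E A (\<lambda>_. {-r..r}))"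
    by (rule emeasure_mono) (auto simp: leb_on_def intro!: sets_PiM_I_finite assms)
  also have "\<dots> = (\<Prod>i\<in>A. ennreal (2 * r))"
    unfolding leb_on_def using assms by (subst measure_times) auto
  also have "\<dots> = ennreal ((2 * r) ^ card A)"
    using assms by (simp add: ennreal_power)
  finally show ?thesis .
qed

text \<open>Read from right to left, it spreads an inverse power over radii beyond \<open>s\<close>;
  with \<open>a = 0\<close> it also evaluates the tail of the inverse square.\<close>

lemma nn_integral_inverse_power_tail:
  assumes "s > (0::real)"
  shows "(\<integral>\<^sup>+r. ennreal (real (Suc a) / r ^ (a + 2)) * indicator {s..} r \<partial>lborel) = ennreal (inverse (s ^ (a + 1)))"
proof -
  have "(\<integral>\<^sup>+r. ennreal (real (Suc a) / r ^ (a + 2)) * indicator {s..} r \<partial>lborel)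
      = ennreal (0 - (- inverse (s ^ (a + 1))))"
  proof (rule nn_integral_FTC_atLeast)
    fix r :: real assume "r \<ge> s"
    with assms have r: "r > 0" by simp
    show "((\<lambda>r. - inverse (r ^ (a + 1))) has_real_derivative real (Suc a) / r ^ (a + 2)) (at r)"
    proof -
      have "((\<lambda>r. r ^ (a + 1)) has_real_derivative real (a + 1) * r ^ a) (at r)"
        using DERIV_pow[of "a + 1" r] by simp
      then show ?thesis
        by (rule DERIV_cong[OF DERIV_minus[OF DERIV_inverse_fun]]) (use r in \<open>auto simp: field_simps\<close>)
    qed
    show "0 \<le> real (Suc a) / r ^ (a + 2)" using r by simp
  next
    have "((\<lambda>r::real. inverse (r ^ (a + 1))) \<longlongrightarrow> 0) at_top"
      by (intro tendsto_inverse_0_at_top filterlim_pow_at_top filterlim_ident) simp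
    then show "((\<lambda>r::real. - inverse (r ^ (a + 1))) \<longlongrightarrow> 0) at_top"
      using tendsto_minus by fastforce
  qed simp
  then show ?thesis by simp
qed

text \<open>Near the origin \<open>1 - cos\<close> is quadratic and tames the singularity of the
  weight; far out it is at most 2 and the weight decays. Balancing the two regimes at radius 1/|y|
  yields linear growth in |y|.\<close>

lemma nn_integral_cos_kernel_le:
  fixes y :: "'i \<Rightarrow> real"
  assumes A: "finite A"
  shows "(\<integral>\<^sup>+u. ennreal ((1 - cos (inner_on A u y)) * inverse (L2_set u A ^ (card A + 1))) \<partial>leb_on A)
    \<le> ennreal (5 / 2 * (real (Suc (card A)) * 2 ^ card A) * L2_set y A)"
proof -
  define a where "a = card A"
  define q where "q = L2_set y A"
  define D where "D = real (Suc a) * 2 ^ a"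
  define \<phi> where "\<phi> u = 1 - cos (inner_on A u y)" for u
  \<comment> \<open>A bound for \<phi> on the ball of radius r: 2 is trivial, the other term is
    \<open>one_minus_cos_le\<close> with Cauchy-Schwarz.\<close>
  define m where "m r = min 2 (r\<^sup>2 * q\<^sup>2 / 2)" for r
  define k :: "('i \<Rightarrow> real) \<Rightarrow> real \<Rightarrow> real" where
    "k u r = \<phi> u * (real (Suc a) / r ^ (a + 2)) * indicator {r. 0 < r \<and> L2_set u A \<le> r} r" for u r
  interpret leb: sigma_finite_measure "leb_on A" by (rule sigma_finite_leb_on) fact
  interpret pair_sigma_finite "leb_on A" lborel ..
  have q: "q \<ge> 0" and D: "D \<ge> 0" and m: "m r \<ge> 0" for r by (auto simp: q_def D_def m_def)
  have \<phi>: "\<phi> u \<ge> 0" for u by (simp add: \<phi>_def)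
  have \<phi>_le: "\<phi> u \<le> m r" if "L2_set u A \<le> r" for u r
  proof -
    have "\<bar>inner_on A u y\<bar> \<le> r * q"
      using abs_inner_on_le[of A u y] mult_right_mono[OF that q] by (simp add: q_def)
    then have "(inner_on A u y)\<^sup>2 \<le> (r * q)\<^sup>2"
      using power_mono[of "\<bar>inner_on A u y\<bar>" "r * q" 2] by simp
    then show ?thesis
      using one_minus_cos_le[of "inner_on A u y"] cos_ge_minus_one[of "inner_on A u y"]
      by (simp add: \<phi>_def m_def power_mult_distrib)
  qed
  have [measurable]: "\<phi> \<in> borel_measurable (leb_on A)" unfolding \<phi>_def by measurable
  have [measurable]: "(\<lambda>s. ennreal (k (fst s) (snd s))) \<in> borel_measurable (leb_on A \<Otimes>\<^sub>M lborel)"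
    unfolding k_def by measurable
  \<comment> \<open>Writing \<open>|u|\<^sup>-\<^sup>a\<^sup>-\<^sup>1\<close> as an integral of \<open>(a + 1) / r\<^sup>a\<^sup>+\<^sup>2\<close> over \<open>r \<ge> |u|\<close> and applying Tonelli
    replaces polar coordinates by the volume of balls.\<close>
  have "(\<integral>\<^sup>+u. ennreal (\<phi> u * inverse (L2_set u A ^ (a + 1))) \<partial>leb_on A)
      \<le> (\<integral>\<^sup>+u. \<integral>\<^sup>+r. ennreal (k u r) \<partial>lborel \<partial>leb_on A)"
  proof (rule nn_integral_mono)
    fix u assume "u \<in> space (leb_on A)"
    show "ennreal (\<phi> u * inverse (L2_set u A ^ (a + 1))) \<le> (\<integral>\<^sup>+r. ennreal (k u r) \<partial>lborel)"
    \<comment> \<open>At norm 0 the inverse is 0 by convention, so the left side vanishes.\<close>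
    proof (cases "L2_set u A = 0")
      case False
      then have s: "L2_set u A > 0" using L2_set_nonneg[of u A] by linarith
      have "(\<integral>\<^sup>+r. ennreal (k u r) \<partial>lborel)
          = (\<integral>\<^sup>+r. ennreal (\<phi> u) * (ennreal (real (Suc a) / r ^ (a + 2)) * indicator {L2_set u A..} r) \<partial>lborel)"
        using s \<phi>[of u] by (intro nn_integral_cong) (auto simp: k_def indicator_def ennreal_mult'[symmetric])
      also have "\<dots> = ennreal (\<phi> u) * ennreal (inverse (L2_set u A ^ (a + 1)))"
        by (subst nn_integral_cmult) (simp, simp only: nn_integral_inverse_power_tail[OF s])
      finally show ?thesis using \<phi>[of u] by (simp add: ennreal_mult')
    qed simp
  qed
  also have "\<dots> = (\<integral>\<^sup>+r. \<integral>\<^sup>+u. ennreal (k u r) \<partial>leb_on A \<partial>lborel)"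
    by (rule Fubini'[symmetric]) (simp add: case_prod_beta')
  also have "\<dots> \<le> (\<integral>\<^sup>+r. ennreal (D * (m r / r\<^sup>2)) * indicator {0<..} r \<partial>lborel)"
  proof (rule nn_integral_mono)
    fix r :: real
    show "(\<integral>\<^sup>+u. ennreal (k u r) \<partial>leb_on A) \<le> ennreal (D * (m r / r\<^sup>2)) * indicator {0<..} r"
    proof (cases "r > 0")
      case True
      let ?c = "ennreal (m r * (real (Suc a) / r ^ (a + 2)))"
      have "(\<integral>\<^sup>+u. ennreal (k u r) \<partial>leb_on A)
          \<le> (\<integral>\<^sup>+u. ?c * indicator {u\<in>space (leb_on A). L2_set u A \<le> r} u \<partial>leb_on A)"
      proof (rule nn_integral_mono)
        fix u assume "u \<in> space (leb_on A)"
        then show "ennreal (k u r) \<le> ?c * indicator {u\<in>space (leb_on A). L2_set u A \<le> r} u"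
          using True \<phi>_le[of u r] 
          by (auto simp: k_def indicator_def intro!: ennreal_leI divide_right_mono mult_right_mono)
      qed
      also have "\<dots> = ?c * emeasure (leb_on A) {u\<in>space (leb_on A). L2_set u A \<le> r}"
        by (rule nn_integral_cmult_indicator) measurable
      also have "\<dots> \<le> ?c * ennreal ((2 * r) ^ a)"
        unfolding a_def using True by (intro mult_left_mono emeasure_leb_on_ball A) auto
      \<comment> \<open>The volume factor cancels all but the inverse square of r; the dimension
        survives only in the constant \<open>D\<close>.\<close>
      also have "\<dots> = ennreal (D * (m r / r\<^sup>2))"
      proof -
        have "m r * (real (Suc a) / r ^ (a + 2)) * (2 * r) ^ a = D * (m r / r\<^sup>2)"
          using True by (simp add: D_def power_mult_distrib power_add field_simps power2_eq_square)
        then show ?thesis using True m[of r] by (simp add: ennreal_mult'[symmetric] del: of_nat_Suc)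
      qed
      finally show ?thesis using True by simp
    qed (simp add: k_def)
  qed
  also have "\<dots> \<le> ennreal (5 / 2 * D * q)"
  proof (cases "q = 0")
    case False
    with q have q0: "q > 0" by simp
    \<comment> \<open>Cutting at \<open>1 / q\<close>, the quadratic bound contributes
      \<open>D * q / 2\<close> and the bound 2 contributes \<open>2 * D * q\<close>, whence the
      constant 5/2.\<close>
    have "(\<integral>\<^sup>+r. ennreal (D * (m r / r\<^sup>2)) * indicator {0<..} r \<partial>lborel)
        \<le> (\<integral>\<^sup>+r. ennreal (D * q\<^sup>2 / 2) * indicator {0..1/q} r
          + ennreal (2 * D) * (ennreal (real (Suc 0) / r ^ (0 + 2)) * indicator {1/q..} r) \<partial>lborel)"
    proof (rule nn_integral_mono)
      fix r :: real
      consider "r \<le> 0" | "0 < r" "r \<le> 1 / q" | "1 / q < r" "r > 0" by linarith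
      then show "ennreal (D * (m r / r\<^sup>2)) * indicator {0<..} r \<le> ennreal (D * q\<^sup>2 / 2) * indicator {0..1/q} r
          + ennreal (2 * D) * (ennreal (real (Suc 0) / r ^ (0 + 2)) * indicator {1/q..} r)"
      proof cases
        case 2
        have "m r / r\<^sup>2 \<le> (r\<^sup>2 * q\<^sup>2 / 2) / r\<^sup>2" by (intro divide_right_mono) (auto simp: m_def)
        then have "D * (m r / r\<^sup>2) \<le> D * (q\<^sup>2 / 2)" using 2 D by (intro mult_left_mono) auto
        then have "ennreal (D * (m r / r\<^sup>2)) \<le> ennreal (D * q\<^sup>2 / 2)" by (intro ennreal_leI) simp
        then show ?thesis using 2 by (auto intro: add_increasing2)
      next
        case 3
        have "m r / r\<^sup>2 \<le> 2 / r\<^sup>2" by (intro divide_right_mono) (auto simp: m_def)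
        then have "D * (m r / r\<^sup>2) \<le> D * (2 / r\<^sup>2)" using D by (intro mult_left_mono) auto
        then have "ennreal (D * (m r / r\<^sup>2)) \<le> ennreal (2 * D * (1 / r\<^sup>2))" by (intro ennreal_leI) (simp add: mult_ac)
        also have "\<dots> = ennreal (2 * D) * ennreal (1 / r\<^sup>2)" using D by (intro ennreal_mult) auto
        finally show ?thesis using 3 by (auto simp: power2_eq_square intro: add_increasing)
      qed simp
    qed
    also have "\<dots> = ennreal (D * q\<^sup>2 / 2) * ennreal (1 / q) + ennreal (2 * D) * ennreal (inverse ((1 / q) ^ (0 + 1)))"
      using q0 nn_integral_inverse_power_tail[of "1 / q" 0]
      by (subst nn_integral_add) (simp_all add: nn_integral_cmult nn_integral_cmult_indicator)
    also have "\<dots> = ennreal (D * q\<^sup>2 / 2 * (1 / q) + 2 * D * inverse ((1 / q) ^ (0 + 1)))"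
      using q0 D by (simp add: ennreal_mult'[symmetric] flip: ennreal_plus)
    also have "D * q\<^sup>2 / 2 * (1 / q) + 2 * D * inverse ((1 / q) ^ (0 + 1)) = 5 / 2 * D * q"
      using q0 by (simp add: field_simps power2_eq_square)
    finally show ?thesis .
  qed (simp add: m_def)
  finally show ?thesis by (simp add: \<phi>_def a_def D_def q_def)
qed

section \<open>The kernel with its normalised weight, and its expectation\<close>

definition marg_weight :: "'i set \<Rightarrow> ('i \<Rightarrow> real) \<Rightarrow> real"
  where "marg_weight A u = inverse (dcov_const (card A) * L2_set u A ^ (card A + 1))"

text \<open>For nonempty finite \<open>A\<close> this is the Euclidean norm of \<open>y\<close>: the
  constant in \<open>marg_weight\<close> is the normalisation that achieves it. The proof works with
  the linear upper bound \<open>cos_kernel_bound\<close>.\<close>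

definition cos_kernel :: "'i set \<Rightarrow> ('i \<Rightarrow> real) \<Rightarrow> real"
  where "cos_kernel A y = (\<integral>u. (1 - cos (inner_on A u y)) * marg_weight A u \<partial>leb_on A)"

lemma dcov_weight_eq: "dcov_weight A B u v = marg_weight A u * marg_weight B v"
  by (simp add: dcov_weight_def marg_weight_def)

lemma dcov_const_pos: "dcov_const q > 0"
  unfolding dcov_const_def by (intro divide_pos_pos Gamma_real_pos) auto

lemma marg_weight_nonneg [simp]: "marg_weight A u \<ge> 0"
  unfolding marg_weight_def using dcov_const_pos[of "card A"] by simp

lemma measurable_marg_weight [measurable]: "marg_weight A \<in> borel_measurable (leb_on A)"
  unfolding marg_weight_def by measurable

lemma nn_integral_cos_kernel_bound:
  assumes "finite A"
  obtains C where "C \<ge> 0" "\<And>y. (\<integral>\<^sup>+u. ennreal ((1 - cos (inner_on A u y)) * marg_weight A u) \<partial>leb_on A)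
    \<le> ennreal (C * L2_set y A)"
proof
  let ?c = "inverse (dcov_const (card A))" and ?C = "5 / 2 * (real (Suc (card A)) * 2 ^ card A)"
  have c: "?c \<ge> 0" using dcov_const_pos[of "card A"] by simp
  then show "?c * ?C \<ge> 0" by (intro mult_nonneg_nonneg) auto
  fix y
  have "(\<integral>\<^sup>+u. ennreal ((1 - cos (inner_on A u y)) * marg_weight A u) \<partial>leb_on A)
    = (\<integral>\<^sup>+u. ennreal ?c * ennreal ((1 - cos (inner_on A u y)) * inverse (L2_set u A ^ (card A + 1))) \<partial>leb_on A)"
    using c by (intro nn_integral_cong) (simp add: marg_weight_def ennreal_mult'[symmetric] mult_ac)
  also have "\<dots> = ennreal ?c * (\<integral>\<^sup>+u. ennreal ((1 - cos (inner_on A u y)) * inverse (L2_set u A ^ (card A + 1))) \<partial>leb_on A)"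
    by (rule nn_integral_cmult) measurable
  also have "\<dots> \<le> ennreal ?c * ennreal (?C * L2_set y A)"
    by (intro mult_left_mono nn_integral_cos_kernel_le assms) simp
  also have "\<dots> = ennreal (?c * ?C * L2_set y A)"
    using c by (subst ennreal_mult'[symmetric]) (auto simp: mult_ac)
  finally show "(\<integral>\<^sup>+u. ennreal ((1 - cos (inner_on A u y)) * marg_weight A u) \<partial>leb_on A)
    \<le> ennreal (?c * ?C * L2_set y A)" .
qed

lemma integrable_cos_kernel:
  assumes "finite A"
  shows "integrable (leb_on A) (\<lambda>u. (1 - cos (inner_on A u y)) * marg_weight A u)"
proof -
  obtain C where "\<And>y. (\<integral>\<^sup>+u. ennreal ((1 - cos (inner_on A u y)) * marg_weight A u) \<partial>leb_on A)
    \<le> ennreal (C * L2_set y A)"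
    using nn_integral_cos_kernel_bound[OF assms] by metis
  from this[of y] show ?thesis
    by (intro integrableI_nonneg) (auto simp: le_less_trans)
qed

lemma cos_kernel_nonneg: "cos_kernel A y \<ge> 0"
  unfolding cos_kernel_def by (intro Bochner_Integration.integral_nonneg) simp

lemma cos_kernel_bound:
  assumes "finite A"
  obtains C where "\<And>y. cos_kernel A y \<le> C * L2_set y A"
proof -
  obtain C where C: "C \<ge> 0" "\<And>y. (\<integral>\<^sup>+u. ennreal ((1 - cos (inner_on A u y)) * marg_weight A u) \<partial>leb_on A)
    \<le> ennreal (C * L2_set y A)"
    using nn_integral_cos_kernel_bound[OF assms] by metis
  have "cos_kernel A y \<le> C * L2_set y A" for y
    using C(2)[of y] C(1) unfolding cos_kernel_def
    by (subst (asm) nn_integral_eq_integral[OF integrable_cos_kernel[OF assms]])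
      (auto simp: ennreal_le_iff L2_set_nonneg)
  then show thesis by (rule that)
qed

lemma measurable_inner_on_pair:
  assumes "\<And>i. i \<in> A \<Longrightarrow> (\<lambda>x. y x i) \<in> borel_measurable M"
  shows "(\<lambda>s. inner_on A (snd s) (y (fst s))) \<in> borel_measurable (M \<Otimes>\<^sub>M leb_on A)"
  by (rule measurable_inner_on) (auto intro: measurable_compose[OF measurable_snd measurable_leb_on_component]
      measurable_compose[OF measurable_fst assms])

lemma measurable_cos_kernel:
  assumes "finite A" "\<And>i. i \<in> A \<Longrightarrow> (\<lambda>x. y x i) \<in> borel_measurable M"
  shows "(\<lambda>x. cos_kernel A (y x)) \<in> borel_measurable M"
proof -
  interpret sigma_finite_measure "leb_on A" by (rule sigma_finite_leb_on) fact
  have [measurable]: "(\<lambda>s. inner_on A (snd s) (y (fst s))) \<in> borel_measurable (M \<Otimes>\<^sub>M leb_on A)"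
    by (rule measurable_inner_on_pair) (rule assms)
  show ?thesis unfolding cos_kernel_def
    by (rule borel_measurable_lebesgue_integral) (simp add: case_prod_beta')
qed

text \<open>The finite first moment enters here, through the linear growth of the kernel.\<close>

lemma integrable_cos_kernel_compose:
  assumes A: "finite A" and m: "\<And>i. i \<in> A \<Longrightarrow> (\<lambda>x. y x i) \<in> borel_measurable M"
    and int: "integrable M (\<lambda>x. L2_set (y x) A)"
  shows "integrable M (\<lambda>x. cos_kernel A (y x))"
proof -
  obtain C where C: "\<And>y. cos_kernel A y \<le> C * L2_set y A"
    using cos_kernel_bound[OF A] by metis
  show ?thesis
  proof (rule Bochner_Integration.integrable_bound)
    show "integrable M (\<lambda>x. C * L2_set (y x) A)" using int by simp
    show "AE x in M. norm (cos_kernel A (y x)) \<le> norm (C * L2_set (y x) A)"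
      by (rule AE_I2) (simp add: cos_kernel_nonneg order_trans[OF C abs_ge_self])
  qed (rule measurable_cos_kernel[OF A m])
qed

text \<open>\<open>1 - Re\<close> of the characteristic function is the expectation of
  \<open>1 - cos\<close>, and Fubini moves this expectation outside the integral over u. Thus the
  integral of each limiting dominating factor is exactly the limit that the strong law assigns to
  the empirical means of the kernel.\<close>

lemma integral_char_fun_kernel:
  fixes M :: "'a measure" and A :: "'i set"
  assumes "prob_space M" and A: "finite A" and m: "\<And>i. i \<in> A \<Longrightarrow> (\<lambda>x. y x i) \<in> borel_measurable M"
    and int: "integrable M (\<lambda>x. L2_set (y x) A)"
  shows "integrable (leb_on A) (\<lambda>u. (1 - Re (char_fun M A y u)) * marg_weight A u)"
    and "(\<integral>u. (1 - Re (char_fun M A y u)) * marg_weight A u \<partial>leb_on A) = (\<integral>x. cos_kernel A (y x) \<partial>M)"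
    and "Re (char_fun M A y u) \<le> 1"
proof -
  interpret prob_space M by fact
  interpret leb: sigma_finite_measure "leb_on A" by (rule sigma_finite_leb_on) fact
  interpret P: pair_sigma_finite M "leb_on A" ..
  let ?f = "\<lambda>x u. (1 - cos (inner_on A u (y x))) * marg_weight A u"
  have [measurable]: "(\<lambda>s. inner_on A (snd s) (y (fst s))) \<in> borel_measurable (M \<Otimes>\<^sub>M leb_on A)"
    by (rule measurable_inner_on_pair) (rule m)
  have [measurable]: "(\<lambda>x. inner_on A u (y x)) \<in> borel_measurable M" for u
    by (rule measurable_inner_on) (auto intro: m)
  have f: "integrable (M \<Otimes>\<^sub>M leb_on A) (\<lambda>(x, u). ?f x u)"
  proof (rule P.Fubini_integrable)
    show "integrable M (\<lambda>x. \<integral>u. norm (case (x, u) of (x, u) \<Rightarrow> ?f x u) \<partial>leb_on A)"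
      using integrable_cos_kernel_compose[OF A m int] by (simp add: cos_kernel_def)
  qed (auto simp: case_prod_beta' intro: integrable_cos_kernel[OF A])
  have Re: "Re (char_fun M A y u) = (\<integral>x. cos (inner_on A u (y x)) \<partial>M)" for u
  proof -
    have "integrable M (\<lambda>x. iexp (inner_on A u (y x)))"
      by (rule integrable_const_bound[where B=1]) auto
    then show ?thesis unfolding char_fun_def by (subst integral_Re[symmetric]) (auto simp: Re_exp)
  qed
  have cos: "integrable M (\<lambda>x. cos (inner_on A u (y x)))" for u
    by (rule integrable_const_bound[where B=1]) auto
  have eq: "(\<integral>x. ?f x u \<partial>M) = (1 - Re (char_fun M A y u)) * marg_weight A u" for u
    using cos[of u] by (simp add: Re prob_space)
  show "integrable (leb_on A) (\<lambda>u. (1 - Re (char_fun M A y u)) * marg_weight A u)"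
    using P.integrable_snd[OF f] unfolding eq .
  show "(\<integral>u. (1 - Re (char_fun M A y u)) * marg_weight A u \<partial>leb_on A) = (\<integral>x. cos_kernel A (y x) \<partial>M)"
    using P.Fubini_integral[OF f] unfolding eq cos_kernel_def .
  show "Re (char_fun M A y u) \<le> 1"
    unfolding Re using integral_mono[OF cos, of "\<lambda>_. 1" u] by (simp add: prob_space)
qed

subsection \<open>Consistency of the empirical distance covariance\<close>

text \<open>The empirical counterpart of \<open>integral_char_fun_kernel\<close>, by linearity of
  the integral over a finite sum.\<close>

lemma empirical_cos_kernel:
  fixes y :: "nat \<Rightarrow> 'i \<Rightarrow> real"
  assumes "finite A"
  defines "G \<equiv> \<lambda>n u. (\<Sum>k=1..n. 1 - cos (inner_on A u (y k))) / real n * marg_weight A u"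
  shows "integrable (leb_on A) (G n)"
    and "integral\<^sup>L (leb_on A) (G n) = (\<Sum>k=1..n. cos_kernel A (y k)) / real n"
    and "G n u \<ge> 0"
proof -
  have "G n = (\<lambda>u. (\<Sum>k=1..n. (1 - cos (inner_on A u (y k))) * marg_weight A u) / real n)"
    by (simp add: G_def sum_distrib_right)
  then show "integrable (leb_on A) (G n)"
    and "integral\<^sup>L (leb_on A) (G n) = (\<Sum>k=1..n. cos_kernel A (y k)) / real n"
    using integrable_cos_kernel[OF \<open>finite A\<close>] by (simp_all add: cos_kernel_def)
  show "G n u \<ge> 0"
    unfolding G_def by (intro mult_nonneg_nonneg divide_nonneg_nonneg sum_nonneg) auto
qed

text \<open>\<open>Y\<close> and \<open>Z\<close> are functions of one common sample, so any two
  sub-vectors can be inserted. Five almost sure limits are collected first; the rest is a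
  deterministic argument for a fixed outcome.\<close>

lemma emp_dcov2_tendsto:
  fixes M :: "'b measure" and Xs :: "nat \<Rightarrow> 'b \<Rightarrow> 'c" and Y :: "'c \<Rightarrow> 'i \<Rightarrow> real" and Z :: "'c \<Rightarrow> 'j \<Rightarrow> real"
  assumes iid: "iid_seq M S (\<lambda>k. Xs (Suc k))"
    and A: "finite A" and B: "finite B"
    and Y: "\<And>i. i \<in> A \<Longrightarrow> (\<lambda>x. Y x i) \<in> borel_measurable S"
    and Z: "\<And>i. i \<in> B \<Longrightarrow> (\<lambda>x. Z x i) \<in> borel_measurable S"
    and intY: "integrable M (\<lambda>\<omega>. L2_set (Y (Xs 1 \<omega>)) A)"
    and intZ: "integrable M (\<lambda>\<omega>. L2_set (Z (Xs 1 \<omega>)) B)"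
  shows "AE \<omega> in M. (\<lambda>n. emp_dcov2 n A (\<lambda>k. Y (Xs k \<omega>)) B (\<lambda>k. Z (Xs k \<omega>)))
    \<longlonglongrightarrow> dcov2 M A (\<lambda>\<omega>. Y (Xs 1 \<omega>)) B (\<lambda>\<omega>. Z (Xs 1 \<omega>))"
proof -
  interpret iid_seq M S "\<lambda>k. Xs (Suc k)" by fact
  interpret A: sigma_finite_measure "leb_on A" by (rule sigma_finite_leb_on) fact
  interpret B: sigma_finite_measure "leb_on B" by (rule sigma_finite_leb_on) fact
  interpret P: pair_sigma_finite "leb_on A" "leb_on B" ..
  let ?P = "leb_on A \<Otimes>\<^sub>M leb_on B"
  have P: "sigma_finite_measure ?P" by unfold_locales
  have Yk: "(\<lambda>\<omega>. Y (Xs 1 \<omega>) i) \<in> borel_measurable M" if "i \<in> A" for i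
    using measurable_compose[OF measurable_W[of 0] Y[OF that]] by simp
  have Zk: "(\<lambda>\<omega>. Z (Xs 1 \<omega>) i) \<in> borel_measurable M" if "i \<in> B" for i
    using measurable_compose[OF measurable_W[of 0] Z[OF that]] by simp
  have mA [measurable]: "(\<lambda>s. inner_on A (fst (fst s)) (y (snd s))) \<in> borel_measurable (?P \<Otimes>\<^sub>M T)"
    if "\<And>i. i \<in> A \<Longrightarrow> (\<lambda>x. y x i) \<in> borel_measurable T" for y and T :: "'t measure"
    by (rule measurable_inner_on)
      (auto intro: measurable_compose[OF measurable_snd that]
        measurable_compose[OF measurable_compose[OF measurable_fst measurable_fst] measurable_leb_on_component])
  have mB [measurable]: "(\<lambda>s. inner_on B (snd (fst s)) (z (snd s))) \<in> borel_measurable (?P \<Otimes>\<^sub>M T)"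
    if "\<And>i. i \<in> B \<Longrightarrow> (\<lambda>x. z x i) \<in> borel_measurable T" for z and T :: "'t measure"
    by (rule measurable_inner_on)
      (auto intro: measurable_compose[OF measurable_snd that]
        measurable_compose[OF measurable_compose[OF measurable_fst measurable_snd] measurable_leb_on_component])
  note [measurable] = mA[OF Y] mB[OF Z] mA[OF Yk[unfolded One_nat_def]] mB[OF Zk[unfolded One_nat_def]]

  define fA where "fA = char_fun M A (\<lambda>\<omega>. Y (Xs 1 \<omega>))"
  define fB where "fB = char_fun M B (\<lambda>\<omega>. Z (Xs 1 \<omega>))"
  define fAB where "fAB = joint_char_fun M A (\<lambda>\<omega>. Y (Xs 1 \<omega>)) B (\<lambda>\<omega>. Z (Xs 1 \<omega>))"
  have [measurable]: "(\<lambda>s. fA (fst s)) \<in> borel_measurable ?P" unfolding fA_def char_fun_def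
    by (rule borel_measurable_lebesgue_integral) (simp add: case_prod_beta')
  have [measurable]: "(\<lambda>s. fB (snd s)) \<in> borel_measurable ?P" unfolding fB_def char_fun_def
    by (rule borel_measurable_lebesgue_integral) (simp add: case_prod_beta')
  have [measurable]: "(\<lambda>s. fAB (fst s) (snd s)) \<in> borel_measurable ?P" unfolding fAB_def joint_char_fun_def
    by (rule borel_measurable_lebesgue_integral) (simp add: case_prod_beta')

  \<comment> \<open>All three limits are stated for almost every pair in \<open>?P\<close>, even
    where only one coordinate matters, so that they can be intersected later. The sums over 1..n are
    shifted to start at 0.\<close>
  have AE_A: "AE \<omega> in M. AE s in ?P. (\<lambda>n. emp_char_fun n A (\<lambda>k. Y (Xs k \<omega>)) (fst s)) \<longlonglongrightarrow> fA (fst s)"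
    unfolding emp_char_fun_def fA_def char_fun_def One_nat_def sum.atLeast1_atMost_eq
    by (rule strong_law_AE_parameter[OF P, where H="\<lambda>s x. iexp (inner_on A (fst s) (Y x))" and B=1]) auto
  have AE_B: "AE \<omega> in M. AE s in ?P. (\<lambda>n. emp_char_fun n B (\<lambda>k. Z (Xs k \<omega>)) (snd s)) \<longlonglongrightarrow> fB (snd s)"
    unfolding emp_char_fun_def fB_def char_fun_def One_nat_def sum.atLeast1_atMost_eq
    by (rule strong_law_AE_parameter[OF P, where H="\<lambda>s x. iexp (inner_on B (snd s) (Z x))" and B=1]) auto
  have AE_AB: "AE \<omega> in M. AE s in ?P.
      (\<lambda>n. emp_joint_char_fun n A (\<lambda>k. Y (Xs k \<omega>)) B (\<lambda>k. Z (Xs k \<omega>)) (fst s) (snd s)) \<longlonglongrightarrow> fAB (fst s) (snd s)"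
    unfolding emp_joint_char_fun_def fAB_def joint_char_fun_def One_nat_def sum.atLeast1_atMost_eq
    by (rule strong_law_AE_parameter[OF P,
          where H="\<lambda>s x. iexp (inner_on A (fst s) (Y x) + inner_on B (snd s) (Z x))" and B=1])
      (auto simp del: of_real_add)
  have AE_kA: "AE \<omega> in M. (\<lambda>n. (\<Sum>k=1..n. cos_kernel A (Y (Xs k \<omega>))) / n)
      \<longlonglongrightarrow> (\<integral>\<omega>. cos_kernel A (Y (Xs 1 \<omega>)) \<partial>M)"
    unfolding One_nat_def sum.atLeast1_atMost_eq
    by (rule strong_law) (use measurable_cos_kernel[OF A Y] integrable_cos_kernel_compose[OF A Yk intY] in auto)
  have AE_kB: "AE \<omega> in M. (\<lambda>n. (\<Sum>k=1..n. cos_kernel B (Z (Xs k \<omega>))) / n)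
      \<longlonglongrightarrow> (\<integral>\<omega>. cos_kernel B (Z (Xs 1 \<omega>)) \<partial>M)"
    unfolding One_nat_def sum.atLeast1_atMost_eq
    by (rule strong_law) (use measurable_cos_kernel[OF B Z] integrable_cos_kernel_compose[OF B Zk intZ] in auto)

  \<comment> \<open>The factors of the limiting dominating function.\<close>
  define gA where "gA u = (1 - Re (fA u)) * marg_weight A u" for u
  define gB where "gB v = (1 - Re (fB v)) * marg_weight B v" for v
  have gA: "integrable (leb_on A) gA" "integral\<^sup>L (leb_on A) gA = (\<integral>\<omega>. cos_kernel A (Y (Xs 1 \<omega>)) \<partial>M)" "gA u \<ge> 0" for u
    using integral_char_fun_kernel[OF prob_space_axioms A Yk intY] by (simp_all add: gA_def[abs_def] fA_def)
  have gB: "integrable (leb_on B) gB" "integral\<^sup>L (leb_on B) gB = (\<integral>\<omega>. cos_kernel B (Z (Xs 1 \<omega>)) \<partial>M)" "gB v \<ge> 0" for v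
    using integral_char_fun_kernel[OF prob_space_axioms B Zk intZ] by (simp_all add: gB_def[abs_def] fB_def)

  from AE_A AE_B AE_AB AE_kA AE_kB show ?thesis
  proof eventually_elim
    case (elim \<omega>)
    define GA where "GA n u = (\<Sum>k=1..n. 1 - cos (inner_on A u (Y (Xs k \<omega>)))) / n * marg_weight A u" for n :: nat and u
    define GB where "GB n v = (\<Sum>k=1..n. 1 - cos (inner_on B v (Z (Xs k \<omega>)))) / n * marg_weight B v" for n :: nat and v
    define f where "f n s = ennreal ((cmod (emp_joint_char_fun n A (\<lambda>k. Y (Xs k \<omega>)) B (\<lambda>k. Z (Xs k \<omega>)) (fst s) (snd s)
        - emp_char_fun n A (\<lambda>k. Y (Xs k \<omega>)) (fst s) * emp_char_fun n B (\<lambda>k. Z (Xs k \<omega>)) (snd s)))\<^sup>2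
      * (marg_weight A (fst s) * marg_weight B (snd s)))" for n s
    define f' where "f' s = ennreal ((cmod (fAB (fst s) (snd s) - fA (fst s) * fB (snd s)))\<^sup>2
      * (marg_weight A (fst s) * marg_weight B (snd s)))" for s
    have GA: "integrable (leb_on A) (GA n)" "integral\<^sup>L (leb_on A) (GA n) = (\<Sum>k=1..n. cos_kernel A (Y (Xs k \<omega>))) / n"
      "GA n u \<ge> 0" for n u
      unfolding GA_def[abs_def] by (rule empirical_cos_kernel[OF A])+
    have GB: "integrable (leb_on B) (GB n)" "integral\<^sup>L (leb_on B) (GB n) = (\<Sum>k=1..n. cos_kernel B (Z (Xs k \<omega>))) / n"
      "GB n v \<ge> 0" for n v
      unfolding GB_def[abs_def] by (rule empirical_cos_kernel[OF B])+
    \<comment> \<open>The bounds \<open>16 * GA n * GB n\<close> vary with n and with the outcome,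
      hence Pratt's lemma rather than dominated convergence with a fixed bound.\<close>
    have "(\<lambda>n. \<integral>\<^sup>+s. f n s \<partial>?P) \<longlonglongrightarrow> (\<integral>\<^sup>+s. f' s \<partial>?P)"
    proof (rule nn_integral_dominated_convergence_general[where
          g="\<lambda>n s. ennreal ((16 * GA n (fst s)) * GB n (snd s))" and g'="\<lambda>s. ennreal ((16 * gA (fst s)) * gB (snd s))"])
      show "f n \<in> borel_measurable ?P" for n
        unfolding f_def emp_joint_char_fun_def emp_char_fun_def by measurable
      show "f' \<in> borel_measurable ?P"
        unfolding f'_def by measurable
      show "(\<lambda>s. ennreal ((16 * GA n (fst s)) * GB n (snd s))) \<in> borel_measurable ?P" for n
        unfolding GA_def GB_def by measurable
      show "(\<lambda>s. ennreal ((16 * gA (fst s)) * gB (snd s))) \<in> borel_measurable ?P"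
        unfolding gA_def gB_def by measurable
    next
      fix n s
      show "f n s \<le> ennreal ((16 * GA n (fst s)) * GB n (snd s))"
        unfolding f_def
      proof (rule ennreal_leI)
        let ?w = "marg_weight A (fst s) * marg_weight B (snd s)"
        have "(cmod (emp_joint_char_fun n A (\<lambda>k. Y (Xs k \<omega>)) B (\<lambda>k. Z (Xs k \<omega>)) (fst s) (snd s)
            - emp_char_fun n A (\<lambda>k. Y (Xs k \<omega>)) (fst s) * emp_char_fun n B (\<lambda>k. Z (Xs k \<omega>)) (snd s)))\<^sup>2 * ?w
          \<le> (16 * ((\<Sum>k=1..n. 1 - cos (inner_on A (fst s) (Y (Xs k \<omega>)))) / n)
              * ((\<Sum>k=1..n. 1 - cos (inner_on B (snd s) (Z (Xs k \<omega>)))) / n)) * ?w"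
          unfolding emp_joint_char_fun_def emp_char_fun_def
          by (intro mult_right_mono emp_covariance_bound) simp
        also have "\<dots> = (16 * GA n (fst s)) * GB n (snd s)"
          by (simp add: GA_def GB_def mult_ac)
        finally show "(cmod (emp_joint_char_fun n A (\<lambda>k. Y (Xs k \<omega>)) B (\<lambda>k. Z (Xs k \<omega>)) (fst s) (snd s)
            - emp_char_fun n A (\<lambda>k. Y (Xs k \<omega>)) (fst s) * emp_char_fun n B (\<lambda>k. Z (Xs k \<omega>)) (snd s)))\<^sup>2 * ?w
          \<le> (16 * GA n (fst s)) * GB n (snd s)" .
      qed
    next
      show "AE s in ?P. (\<lambda>n. f n s) \<longlonglongrightarrow> f' s"
        using elim(1-3) unfolding f_def f'_def
        by eventually_elim (intro tendsto_intros)
    next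
      show "AE s in ?P. (\<lambda>n. ennreal ((16 * GA n (fst s)) * GB n (snd s))) \<longlonglongrightarrow> ennreal ((16 * gA (fst s)) * gB (snd s))"
        using elim(1-2)
      proof eventually_elim
        case (elim s)
        \<comment> \<open>Only eventually true: for \<open>n = 0\<close> the left side is 1 and the
          right side 0.\<close>
        have Re: "\<forall>\<^sub>F n in sequentially. 1 - Re ((\<Sum>k=1..n. iexp (c k)) / of_nat n)
            = (\<Sum>k=1..n. 1 - cos (c k)) / real n" for c :: "nat \<Rightarrow> real"
          using eventually_gt_at_top[of 0]
          by eventually_elim (simp add: sum_subtractf Re_exp Re_divide_of_nat field_simps)
        have "(\<lambda>n. 1 - Re (emp_char_fun n A (\<lambda>k. Y (Xs k \<omega>)) (fst s))) \<longlonglongrightarrow> 1 - Re (fA (fst s))"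
          by (intro tendsto_intros elim)
        then have "(\<lambda>n. (\<Sum>k=1..n. 1 - cos (inner_on A (fst s) (Y (Xs k \<omega>)))) / n) \<longlonglongrightarrow> 1 - Re (fA (fst s))"
          unfolding emp_char_fun_def by (rule Lim_transform_eventually[OF _ Re])
        moreover have "(\<lambda>n. 1 - Re (emp_char_fun n B (\<lambda>k. Z (Xs k \<omega>)) (snd s))) \<longlonglongrightarrow> 1 - Re (fB (snd s))"
          by (intro tendsto_intros elim)
        then have "(\<lambda>n. (\<Sum>k=1..n. 1 - cos (inner_on B (snd s) (Z (Xs k \<omega>)))) / n) \<longlonglongrightarrow> 1 - Re (fB (snd s))"
          unfolding emp_char_fun_def by (rule Lim_transform_eventually[OF _ Re])
        ultimately show ?case
          unfolding GA_def GB_def gA_def gB_def by (intro tendsto_intros)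
      qed
    next
      \<comment> \<open>Both integrals factor, so the convergence of the dominating integrals
        reduces to the two strong laws for the kernel means.\<close>
      have g: "(\<integral>\<^sup>+s. ennreal ((16 * gA (fst s)) * gB (snd s)) \<partial>?P)
          = ennreal ((\<integral>u. 16 * gA u \<partial>leb_on A) * (\<integral>v. gB v \<partial>leb_on B))"
        by (rule nn_integral_pair_product) (use gA gB in \<open>auto simp: B.sigma_finite_measure_axioms\<close>)
      have G: "(\<integral>\<^sup>+s. ennreal ((16 * GA n (fst s)) * GB n (snd s)) \<partial>?P)
          = ennreal ((\<integral>u. 16 * GA n u \<partial>leb_on A) * (\<integral>v. GB n v \<partial>leb_on B))" for n
        by (rule nn_integral_pair_product) (use GA GB in \<open>auto simp: B.sigma_finite_measure_axioms\<close>)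
      show "(\<integral>\<^sup>+s. ennreal ((16 * gA (fst s)) * gB (snd s)) \<partial>?P) < \<infinity>"
        unfolding g by simp
      show "(\<lambda>n. \<integral>\<^sup>+s. ennreal ((16 * GA n (fst s)) * GB n (snd s)) \<partial>?P)
          \<longlonglongrightarrow> (\<integral>\<^sup>+s. ennreal ((16 * gA (fst s)) * gB (snd s)) \<partial>?P)"
        unfolding g G integral_mult_right_zero GA GB gA gB
        by (intro tendsto_intros elim(4,5))
    qed
    then show ?case
      unfolding emp_dcov2_def dcov2_def dcov_integral_def f_def f'_def dcov_weight_eq case_prod_beta'
        fA_def fB_def fAB_def .
  qed
qed


text \<open>Distance covariance depends on the law alone. This links the sample space
  \<open>M\<close> to the space \<open>N\<close> on which the population vector lives.\<close>

lemma dcov2_distr_cong: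
  assumes X: "X \<in> measurable M S" and X': "X' \<in> measurable N S" and eq: "distr M S X = distr N S X'"
    and Y: "\<And>i. i \<in> A \<Longrightarrow> (\<lambda>x. Y x i) \<in> borel_measurable S"
    and Z: "\<And>i. i \<in> B \<Longrightarrow> (\<lambda>x. Z x i) \<in> borel_measurable S"
  shows "dcov2 M A (\<lambda>\<omega>. Y (X \<omega>)) B (\<lambda>\<omega>. Z (X \<omega>)) = dcov2 N A (\<lambda>\<omega>. Y (X' \<omega>)) B (\<lambda>\<omega>. Z (X' \<omega>))"
proof -
  have int: "(CLINT \<omega>|M. h (X \<omega>)) = (CLINT \<omega>|N. h (X' \<omega>))" if "h \<in> borel_measurable S" for h :: "_ \<Rightarrow> complex"
    using integral_distr[OF X that] integral_distr[OF X' that] eq by simp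
  have [measurable]: "(\<lambda>x. inner_on A u (Y x)) \<in> borel_measurable S" "(\<lambda>x. inner_on B v (Z x)) \<in> borel_measurable S" for u v
    using Y Z by (auto intro!: measurable_inner_on)
  show ?thesis
    unfolding dcov2_def joint_char_fun_def[abs_def] char_fun_def[abs_def]
    by (subst (1 2 3) int) measurable
qed

section \<open>Passage to sub-vectors\<close>

lemma finite_coords: "finite J \<Longrightarrow> finite (coords p J)"
  by (simp add: coords_def)

lemma coords_mono: "J \<subseteq> K \<Longrightarrow> coords p J \<subseteq> coords p K"
  by (auto simp: coords_def)

lemma L2_set_subset_mono: "finite B \<Longrightarrow> A \<subseteq> B \<Longrightarrow> L2_set f A \<le> L2_set f B"
  unfolding L2_set_def by (intro real_sqrt_le_mono sum_mono2) auto

lemma subvec_apply: "i \<in> coords p J \<Longrightarrow> subvec p J x i = x i"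
  by (simp add: subvec_def)

lemma L2_set_subvec: "L2_set (subvec p J x) (coords p J) = L2_set x (coords p J)"
  by (rule L2_set_cong) (auto simp: subvec_apply)

text \<open>The norm of a sub-vector is at most that of the whole vector, so a single moment
  hypothesis serves every choice of \<open>J\<close> and \<open>K\<close>; the statement covers the
  summands of both statistics.\<close>

lemma emp_dcov2_parts_tendsto:
  fixes N :: "'a measure" and M :: "'b measure"
  assumes N: "prob_space N" and M: "prob_space M" and D: "finite D" "J \<subseteq> D" "K \<subseteq> D"
    and X: "X \<in> measurable N (leb_on (coords p D))"
    and indep: "prob_space.indep_vars M (\<lambda>_. leb_on (coords p D)) Xs {1..}"
    and distr: "\<And>k. k \<ge> 1 \<Longrightarrow> distr M (leb_on (coords p D)) (Xs k) = distr N (leb_on (coords p D)) X"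
    and int: "integrable N (\<lambda>\<omega>. L2_set (X \<omega>) (coords p D))"
  shows "AE \<omega> in M. (\<lambda>n. emp_dcov2_parts p n (\<lambda>k. Xs k \<omega>) J K) \<longlonglongrightarrow> dcov2_parts p N X J K"
proof -
  let ?S = "leb_on (coords p D)"
  interpret M: prob_space M by fact
  \<comment> \<open>The sample is indexed from 1, the locale from 0.\<close>
  have "range Suc = {1..}"
    by (auto simp: image_def Suc_le_eq dest: gr0_implies_Suc)
  then have "M.indep_vars (\<lambda>_. ?S) (\<lambda>k. Xs (Suc k)) UNIV"
    using indep by (intro M.indep_vars_reindex[of Suc UNIV "\<lambda>_. ?S" Xs]) auto
  then interpret iid_seq M ?S "\<lambda>k. Xs (Suc k)"
    by unfold_locales (auto simp: distr)
  have X1: "Xs 1 \<in> measurable M ?S" using measurable_W[of 0] by simp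
  have meas: "(\<lambda>x. subvec p L x i) \<in> borel_measurable ?S" if "L \<subseteq> D" "i \<in> coords p L" for L i
    using that coords_mono[OF that(1), of p] by (auto simp: subvec_apply intro!: measurable_leb_on_component)
  have intL: "integrable M (\<lambda>\<omega>. L2_set (subvec p L (Xs 1 \<omega>)) (coords p L))" if L: "L \<subseteq> D" for L
  proof (rule Bochner_Integration.integrable_bound)
    show "integrable M (\<lambda>\<omega>. L2_set (Xs 1 \<omega>) (coords p D))"
      using int integrable_distr_eq[OF X1, of "\<lambda>x. L2_set x (coords p D)"]
        integrable_distr_eq[OF X, of "\<lambda>x. L2_set x (coords p D)"] distr[of 1]
      by simp
    show "AE \<omega> in M. norm (L2_set (subvec p L (Xs 1 \<omega>)) (coords p L)) \<le> norm (L2_set (Xs 1 \<omega>) (coords p D))"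
      using L2_set_subset_mono[OF finite_coords[OF D(1)] coords_mono[OF L]]
      by (auto simp: L2_set_subvec L2_set_nonneg)
    show "(\<lambda>\<omega>. L2_set (subvec p L (Xs 1 \<omega>)) (coords p L)) \<in> borel_measurable M"
      by (rule measurable_L2_set) (rule measurable_compose[OF X1 meas[OF L]])
  qed
  have fin: "finite (coords p L)" if "L \<subseteq> D" for L
    using that D(1) by (intro finite_coords) (rule finite_subset)
  have "AE \<omega> in M. (\<lambda>n. emp_dcov2_parts p n (\<lambda>k. Xs k \<omega>) J K)
      \<longlonglongrightarrow> dcov2 M (coords p J) (\<lambda>\<omega>. subvec p J (Xs 1 \<omega>)) (coords p K) (\<lambda>\<omega>. subvec p K (Xs 1 \<omega>))"
    unfolding emp_dcov2_parts_def
    by (rule emp_dcov2_tendsto[OF iid_seq_axioms]) (use D in \<open>auto simp del: One_nat_def intro!: fin meas intL\<close>)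
  also have "dcov2 M (coords p J) (\<lambda>\<omega>. subvec p J (Xs 1 \<omega>)) (coords p K) (\<lambda>\<omega>. subvec p K (Xs 1 \<omega>))
      = dcov2_parts p N X J K"
    unfolding dcov2_parts_def
    by (rule dcov2_distr_cong[OF X1 X distr]) (use D in \<open>auto intro: meas\<close>)
  finally show ?thesis .
qed

theorem theorem5:
  fixes N :: "'a measure" and M :: "'b measure"
    and d :: nat and p :: "nat \<Rightarrow> nat"
    and X :: "'a \<Rightarrow> nat \<times> nat \<Rightarrow> real"
    and Xs :: "nat \<Rightarrow> 'b \<Rightarrow> nat \<times> nat \<Rightarrow> real"
  assumes "prob_space N" and "prob_space M"
    and "d \<ge> 2"
    and "\<And>j. j \<in> {1..d} \<Longrightarrow> p j \<ge> 1"
    and "X \<in> measurable N (leb_on (coords p {1..d}))"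
    and "\<And>j. j \<in> {1..d} \<Longrightarrow>
      absolutely_continuous (leb_on (coords p {j}))
        (distr N (leb_on (coords p {j})) (\<lambda>\<omega>. subvec p {j} (X \<omega>)))"
    and "prob_space.indep_vars M (\<lambda>_. leb_on (coords p {1..d})) Xs {1..}"
    and "\<And>k. k \<ge> 1 \<Longrightarrow>
      distr M (leb_on (coords p {1..d})) (Xs k) = distr N (leb_on (coords p {1..d})) X"
    and "integrable N (\<lambda>\<omega>. L2_set (X \<omega>) (coords p {1..d}))"
  shows "AE \<omega> in M.
    (\<lambda>n. emp_R_dcov d p n (\<lambda>k. Xs k \<omega>)) \<longlonglongrightarrow> R_dcov d p N X \<and>
    (\<lambda>n. emp_S_dcov d p n (\<lambda>k. Xs k \<omega>)) \<longlonglongrightarrow> S_dcov d p N X"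
proof -
  note parts = emp_dcov2_parts_tendsto[OF assms(1,2) _ _ _ assms(5,7,8,9), OF finite_atLeastAtMost]
  \<comment> \<open>There are finitely many c, so one null set serves all summands and the limits
    add up.\<close>
  have "AE \<omega> in M. \<forall>c\<in>{1..d-1}. (\<lambda>n. emp_dcov2_parts p n (\<lambda>k. Xs k \<omega>) {c} {c+1..d})
      \<longlonglongrightarrow> dcov2_parts p N X {c} {c+1..d}"
    by (intro AE_finite_allI finite_atLeastAtMost parts) auto
  moreover have "AE \<omega> in M. \<forall>c\<in>{1..d}. (\<lambda>n. emp_dcov2_parts p n (\<lambda>k. Xs k \<omega>) {c} ({1..d} - {c}))
      \<longlonglongrightarrow> dcov2_parts p N X {c} ({1..d} - {c})"
    by (intro AE_finite_allI finite_atLeastAtMost parts) auto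
  ultimately show ?thesis
  proof eventually_elim
    case (elim \<omega>)
    then show ?case
      unfolding emp_R_dcov_def R_dcov_def emp_S_dcov_def S_dcov_def
      by (intro conjI tendsto_sum) blast+
  qed
qed

end
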